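(* Let $\phi=\Phi^{kN}$, with Wiener--Hopf factorization $\phi=\widetilde\phi_-\widetilde\phi_+$. Assume that $\psi_{0,+}$ and $\psi_{0,-}$ are right and left nullvectors of $\Phi(z)-wI$ respectively, i.e. $$(\Phi(z)-wI)\psi_{0,+}(z,w)=0,\qquad \psi_{0,-}(z,w)(\Phi(z)-wI)=0 .$$ If $\psi_{kN,+}$ and $\psi_{kN,-}$ are obtained via the recursion $$\psi_{j+1,+}(z,w)=(\Phi_j)_+(z)\psi_{j,+}(z,w),\qquad\psi_{j+1,-}(z,w)=\psi_{j,-}(z,w)(\Phi_j)_-(z),\qquad j=0,1,\dots,kN-1,$$ then $$z^{\ell N}C\psi_{kN,+}(z,w)=\widetilde\phi_+(z)\psi_{0,+}(z,w)\quad\text{and}\quad\psi_{kN,-}(z,w)z^{-\ell N}C^{-1}=\psi_{0,-}(z,w)\widetilde\phi_-(z),$$ where $C$ is an invertible constant $k\times k$ matrix.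
   Context: Fix integers $k,\ell,N\ge1$ and reals $\alpha_{j,i},\beta_{j,i},\gamma_{j,i}>0$ ($1\le j\le k$, $1\le i\le\ell$). Put $\alpha^v_i=\prod_j\alpha_{j,i}$, $\beta^v_i=\prod_j\beta_{j,i}$, $\gamma^v_i=\prod_j\gamma_{j,i}$. Standing assumption: $\beta^v_i<1<\alpha^v_i/\gamma^v_i$ for all $i$. For $\vec\alpha,\vec\gamma\in\mathbb C^k$, $\phi^b(z;\vec\alpha,\vec\gamma)$ is the $k\times k$ matrix with diagonal $\gamma_1,\dots,\gamma_k$, entries $\alpha_r$ at $(r+1,r)$ ($1\le r\le k-1$), $\alpha_kz^{-1}$ at $(1,k)$, zeros elsewhere (for $k=1$: $\gamma_1+\alpha_1z^{-1}$). For $\vec\beta\in\mathbb C^k$, $\phi^g(z;\vec\beta)=\phi^b(z;-\vec\beta,\vec1)^{-1}$, $\vec1=(1,\dots,1)$. Put $\phi_{2i-1}(z)=\phi^b(z;(\alpha_{j,i})_j,(\gamma_{j,i})_j)$, $\phi_{2i}(z)=\phi^g(z;(\beta_{j,i})_j)$ and $\Phi=\phi_1\phi_2\cdots\phi_{2\ell}$. Wiener--Hopf factorization. $\phi=\widetilde\phi_-\widetilde\phi_+$ on the unit circle, where $\widetilde\phi_+^{\pm1}$ are analytic in the unit disc, $\widetilde\phi_-^{\pm1}$ are analytic outside the closed unit disc (both continuous up to the boundary), and $\widetilde\phi_-(z)\sim z^{-\ell N}I$ as $z\to\infty$. Under the standing assumption it exists and is unique; $\widetilde\phi_\pm$ extend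 meromorphically to $\mathbb C^*$ through $\phi=\widetilde\phi_-\widetilde\phi_+$. Recursive re-factorization. For $\vec\alpha,\vec\beta,\vec\gamma\in\mathbb R_{>0}^k$ the switching rule $\phi^b(z;\vec\alpha,\vec\gamma)\phi^g(z;\vec\beta)=\phi^g(z;\vec\beta')\phi^b(z;\vec\alpha',\vec\gamma)$ holds with $\alpha'_i=\alpha_{i-1}\frac{\alpha_i+\gamma_{i+1}\beta_i}{\alpha_{i-1}+\gamma_i\beta_{i-1}}$, $\beta'_i=\beta_{i-1}\frac{\alpha_i+\gamma_{i+1}\beta_i}{\alpha_{i-1}+\gamma_i\beta_{i-1}}$ (indices modulo $k$). Put $\Phi_0=\Phi$. Given $\Phi_j$ as a product of $\ell$ factors of type $\phi^b$ and $\ell$ factors of type $\phi^g$ with positive parameters, apply the switching rule repeatedly until all $\phi^g$ factors stand to the left of all $\phi^b$ factors; this gives $\Phi_j=(\Phi_j)_-(\Phi_j)_+$ where $(\Phi_j)_-$ is the product of the $\ell$ resulting $\phi^g$ factors and $(\Phi_j)_+$ the product of the $\ell$ resulting $\phi^b$ factors. Then $\Phi_{j+1}=(\Phi_j)_+(\Phi_j)_-$, and one iterates. The nullvectors $\psi_{j,+}$ (column vectors) and $\psi_{j,-}$ (row vectors) are considered on the spectral curve, i.e. at points $(z,w)\in(\mathbb C^* )^2$ with $\det(\Phi(z)-wI)=0$; $\psi_{j,\pm}$ are then nullvectors of $\Phi_j(z)-wI$. *)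

theory Defs
  imports
    "HOL-Analysis.Complex_Analysis_Basics"
    "Jordan_Normal_Form.Determinant"
    "Jordan_Normal_Form.Gauss_Jordan_Elimination"
begin

text \<open>
  All indices are zero-based: the index \<open>j\<close> of \<open>\<alpha> j i\<close> ranges over \<open>j < k\<close> and \<open>i\<close> over \<open>i < l\<close>.
  A parameter vector of length \<open>k\<close> is a function on \<open>nat\<close> of which only the values at
  arguments below \<open>k\<close> matter.
\<close>

section \<open>The factors\<close>

text \<open>Junk value for singular matrices.\<close>

definition mat_inv :: "complex mat \<Rightarrow> complex mat" where
  "mat_inv A = the (mat_inverse A)"

text \<open>The entries are written as sums, because the diagonal and the corner coincide if \<open>k = 1\<close>.\<close>

definition phi_b :: "nat \<Rightarrow> complex \<Rightarrow> (nat \<Rightarrow> complex) \<Rightarrow> (nat \<Rightarrow> complex) \<Rightarrow> complex mat" where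
  "phi_b k z a c = mat k k (\<lambda>(r, s).
     (if r = s then c r else 0)
     + (if r = s + 1 then a s else 0)
     + (if r = 0 \<and> s = k - 1 then a (k - 1) / z else 0))"

definition phi_g :: "nat \<Rightarrow> complex \<Rightarrow> (nat \<Rightarrow> complex) \<Rightarrow> complex mat" where
  "phi_g k z b = mat_inv (phi_b k z (\<lambda>j. - b j) (\<lambda>_. 1))"

datatype factor = Bfac "nat \<Rightarrow> real" "nat \<Rightarrow> real" | Gfac "nat \<Rightarrow> real"

fun is_Bfac :: "factor \<Rightarrow> bool" where
  "is_Bfac (Bfac a c) = True"
| "is_Bfac (Gfac b) = False"

fun fac_mat :: "nat \<Rightarrow> complex \<Rightarrow> factor \<Rightarrow> complex mat" where
  "fac_mat k z (Bfac a c) = phi_b k z (\<lambda>j. of_real (a j)) (\<lambda>j. of_real (c j))"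
| "fac_mat k z (Gfac b) = phi_g k z (\<lambda>j. of_real (b j))"

definition prod_mat :: "nat \<Rightarrow> complex \<Rightarrow> factor list \<Rightarrow> complex mat" where
  "prod_mat k z fs = foldr (\<lambda>f A. fac_mat k z f * A) fs (1\<^sub>m k)"

definition Phi_factors ::
  "nat \<Rightarrow> (nat \<Rightarrow> nat \<Rightarrow> real) \<Rightarrow> (nat \<Rightarrow> nat \<Rightarrow> real) \<Rightarrow> (nat \<Rightarrow> nat \<Rightarrow> real) \<Rightarrow> factor list" where
  "Phi_factors l \<alpha> \<beta> \<gamma> =
     concat (map (\<lambda>i. [Bfac (\<lambda>j. \<alpha> j i) (\<lambda>j. \<gamma> j i), Gfac (\<lambda>j. \<beta> j i)]) [0..<l])"

definition Phi ::
  "nat \<Rightarrow> nat \<Rightarrow> (nat \<Rightarrow> nat \<Rightarrow> real) \<Rightarrow> (nat \<Rightarrow> nat \<Rightarrow> real) \<Rightarrow> (nat \<Rightarrow> nat \<Rightarrow> real)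
    \<Rightarrow> complex \<Rightarrow> complex mat" where
  "Phi k l \<alpha> \<beta> \<gamma> z = prod_mat k z (Phi_factors l \<alpha> \<beta> \<gamma>)"

text \<open>
  \<open>Phi\<close> is undefined (it has a pole) exactly where one of the matrices inverted in its
  \<open>phi_g\<close>-factors is singular; such \<open>z\<close> do not belong to the spectral curve.
\<close>

definition spectral_curve ::
  "nat \<Rightarrow> nat \<Rightarrow> (nat \<Rightarrow> nat \<Rightarrow> real) \<Rightarrow> (nat \<Rightarrow> nat \<Rightarrow> real) \<Rightarrow> (nat \<Rightarrow> nat \<Rightarrow> real)
    \<Rightarrow> (complex \<times> complex) set" where
  "spectral_curve k l \<alpha> \<beta> \<gamma> = {(z, w). z \<noteq> 0 \<and> w \<noteq> 0
     \<and> (\<forall>i<l. invertible_mat (phi_b k z (\<lambda>j. - of_real (\<beta> j i)) (\<lambda>_. 1)))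
     \<and> det (Phi k l \<alpha> \<beta> \<gamma> z - w \<cdot>\<^sub>m 1\<^sub>m k) = 0}"

section \<open>Recursive re-factorization\<close>

definition switch_ratio ::
  "nat \<Rightarrow> (nat \<Rightarrow> real) \<Rightarrow> (nat \<Rightarrow> real) \<Rightarrow> (nat \<Rightarrow> real) \<Rightarrow> nat \<Rightarrow> real" where
  "switch_ratio k a b c i =
     (let p = (i + k - 1) mod k; s = (i + 1) mod k
      in (a i + c s * b i) / (a p + c i * b p))"

inductive switch :: "nat \<Rightarrow> factor list \<Rightarrow> factor list \<Rightarrow> bool" for k where
  "switch k (xs @ Bfac a c # Gfac b # ys)
     (xs @ Gfac (\<lambda>i. b ((i + k - 1) mod k) * switch_ratio k a b c i)
         # Bfac (\<lambda>i. a ((i + k - 1) mod k) * switch_ratio k a b c i) c # ys)"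

text \<open>
  \<open>F j\<close> lists the factors of \<open>\<Phi>\<^sub>j\<close>, and \<open>gs j\<close> and \<open>bs j\<close> those of
  \<open>(\<Phi>\<^sub>j)\<^sub>-\<close> and \<open>(\<Phi>\<^sub>j)\<^sub>+\<close>. The switches may be carried out in any order.
\<close>

definition refactorization ::
  "nat \<Rightarrow> factor list \<Rightarrow> (nat \<Rightarrow> factor list) \<Rightarrow> (nat \<Rightarrow> factor list) \<Rightarrow> (nat \<Rightarrow> factor list) \<Rightarrow> bool"
where
  "refactorization k fs F gs bs \<longleftrightarrow>
     F 0 = fs \<and>
     (\<forall>j. (switch k)\<^sup>*\<^sup>* (F j) (gs j @ bs j)
        \<and> (\<forall>f\<in>set (gs j). \<not> is_Bfac f) \<and> (\<forall>f\<in>set (bs j). is_Bfac f)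
        \<and> F (Suc j) = bs j @ gs j)"

lemma switch_Cons: "(switch k)\<^sup>*\<^sup>* xs ys \<Longrightarrow> (switch k)\<^sup>*\<^sup>* (f # xs) (f # ys)"
proof (induction rule: rtranclp_induct)
  case (step ys zs)
  from step.hyps(2) have "switch k (f # ys) (f # zs)"
  proof (cases rule: switch.cases)
    case (1 us a c b vs)
    show ?thesis
      unfolding 1 using switch.intros[of k "f # us" a c b vs] by (simp only: append_Cons)
  qed
  with step.IH show ?case by (rule rtranclp.rtrancl_into_rtrancl)
qed simp

lemma switch_past:
  assumes "\<forall>f\<in>set gs. \<not> is_Bfac f"
  shows "\<exists>gs' a'. (\<forall>f\<in>set gs'. \<not> is_Bfac f)
    \<and> (switch k)\<^sup>*\<^sup>* (Bfac a c # gs @ bs) (gs' @ Bfac a' c # bs)"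
  using assms
proof (induction gs arbitrary: a)
  case Nil
  have "(switch k)\<^sup>*\<^sup>* (Bfac a c # [] @ bs) ([] @ Bfac a c # bs)" by simp
  then show ?case by (metis empty_iff list.set(1))
next
  case (Cons g gs)
  then obtain b where g: "g = Gfac b" by (cases g) auto
  obtain b' a1 where s: "switch k (Bfac a c # (g # gs) @ bs) (Gfac b' # Bfac a1 c # gs @ bs)"
    using switch.intros[of k "[]" a c b "gs @ bs"] unfolding g append_Cons append_Nil by blast
  have "\<forall>f\<in>set gs. \<not> is_Bfac f" using Cons.prems by simp
  from Cons.IH[OF this, of a1] obtain gs' a' where *: "\<forall>f\<in>set gs'. \<not> is_Bfac f"
    "(switch k)\<^sup>*\<^sup>* (Bfac a1 c # gs @ bs) (gs' @ Bfac a' c # bs)" by blast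
  from s switch_Cons[OF *(2), of "Gfac b'"]
  have "(switch k)\<^sup>*\<^sup>* (Bfac a c # (g # gs) @ bs) ((Gfac b' # gs') @ Bfac a' c # bs)"
    by (simp only: append_Cons converse_rtranclp_into_rtranclp)
  with *(1) show ?case by (intro exI[of _ "Gfac b' # gs'"] exI[of _ a'] conjI) simp_all
qed

lemma switch_normal_form:
  "\<exists>gs bs. (switch k)\<^sup>*\<^sup>* fs (gs @ bs) \<and> (\<forall>f\<in>set gs. \<not> is_Bfac f) \<and> (\<forall>f\<in>set bs. is_Bfac f)"
proof (induction fs)
  case Nil
  show ?case by (intro exI[of _ "[]"]) simp
next
  case (Cons f fs)
  then obtain gs bs where *: "(switch k)\<^sup>*\<^sup>* fs (gs @ bs)"
    "\<forall>f\<in>set gs. \<not> is_Bfac f" "\<forall>f\<in>set bs. is_Bfac f" by blast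
  show ?case
  proof (cases f)
    case (Bfac a c)
    from switch_past[OF *(2)] obtain gs' a' where "\<forall>f\<in>set gs'. \<not> is_Bfac f"
      "(switch k)\<^sup>*\<^sup>* (Bfac a c # gs @ bs) (gs' @ Bfac a' c # bs)" by blast
    note new = this
    have "(switch k)\<^sup>*\<^sup>* (f # fs) (gs' @ Bfac a' c # bs)"
      using rtranclp_trans[OF switch_Cons[OF *(1), of f]] new(2) unfolding Bfac by blast
    with new(1) *(3) show ?thesis
      by (intro exI[of _ gs'] exI[of _ "Bfac a' c # bs"] conjI) simp_all
  next
    case (Gfac b)
    with switch_Cons[OF *(1), of f] *(2,3) show ?thesis
      by (intro exI[of _ "f # gs"] exI[of _ bs] conjI) simp_all
  qed
qed

lemma refactorization_exists: "\<exists>F gs bs. refactorization k fs F gs bs"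
proof -
  obtain g b where gb: "\<And>fs. (switch k)\<^sup>*\<^sup>* fs (g fs @ b fs)
    \<and> (\<forall>f\<in>set (g fs). \<not> is_Bfac f) \<and> (\<forall>f\<in>set (b fs). is_Bfac f)"
    using switch_normal_form[of k] by metis
  define F where "F = rec_nat fs (\<lambda>_ fs'. b fs' @ g fs')"
  have "refactorization k fs F (\<lambda>j. g (F j)) (\<lambda>j. b (F j))"
    unfolding refactorization_def using gb by (simp add: F_def)
  then show ?thesis by blast
qed

section \<open>Wiener--Hopf factorization\<close>

definition mat_analytic_on :: "nat \<Rightarrow> (complex \<Rightarrow> complex mat) \<Rightarrow> complex set \<Rightarrow> bool" where
  "mat_analytic_on k A S \<longleftrightarrow> (\<forall>i<k. \<forall>j<k. (\<lambda>z. A z $$ (i, j)) analytic_on S)"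

definition mat_continuous_on :: "nat \<Rightarrow> complex set \<Rightarrow> (complex \<Rightarrow> complex mat) \<Rightarrow> bool" where
  "mat_continuous_on k S A \<longleftrightarrow> (\<forall>i<k. \<forall>j<k. continuous_on S (\<lambda>z. A z $$ (i, j)))"

text \<open>
  \<open>\<phi> = M P\<close> on the unit circle, with \<open>M z\<close> asymptotic to \<open>z\<^sup>-\<^sup>m I\<close> at infinity. The values of
  \<open>M\<close> inside and of \<open>P\<close> outside the unit circle are irrelevant here.
\<close>

definition wiener_hopf ::
  "nat \<Rightarrow> nat \<Rightarrow> (complex \<Rightarrow> complex mat) \<Rightarrow> (complex \<Rightarrow> complex mat) \<Rightarrow> (complex \<Rightarrow> complex mat)
    \<Rightarrow> bool" where
  "wiener_hopf k m \<phi> M P \<longleftrightarrow>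
     (\<forall>z\<in>sphere 0 1. \<phi> z = M z * P z) \<and>
     (\<forall>z\<in>cball 0 1. P z \<in> carrier_mat k k \<and> invertible_mat (P z)) \<and>
     mat_analytic_on k P (ball 0 1) \<and> mat_analytic_on k (\<lambda>z. mat_inv (P z)) (ball 0 1) \<and>
     mat_continuous_on k (cball 0 1) P \<and> mat_continuous_on k (cball 0 1) (\<lambda>z. mat_inv (P z)) \<and>
     (\<forall>z\<in>- ball 0 1. M z \<in> carrier_mat k k \<and> invertible_mat (M z)) \<and>
     mat_analytic_on k M (- cball 0 1) \<and> mat_analytic_on k (\<lambda>z. mat_inv (M z)) (- cball 0 1) \<and>
     mat_continuous_on k (- ball 0 1) M \<and> mat_continuous_on k (- ball 0 1) (\<lambda>z. mat_inv (M z)) \<and>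
     (\<forall>i<k. \<forall>j<k. ((\<lambda>z. z ^ m * (M z $$ (i, j))) \<longlongrightarrow> 1\<^sub>m k $$ (i, j)) at_infinity)"

text \<open>
  The meromorphic extensions of \<open>M\<close> and \<open>P\<close> to the punctured plane through \<open>\<phi> = M P\<close>. At the
  poles of \<open>\<phi>\<close> the value of \<open>ext_minus\<close> is meaningless.
\<close>

definition ext_minus ::
  "(complex \<Rightarrow> complex mat) \<Rightarrow> (complex \<Rightarrow> complex mat) \<Rightarrow> (complex \<Rightarrow> complex mat)
    \<Rightarrow> complex \<Rightarrow> complex mat" where
  "ext_minus \<phi> M P z = (if norm z \<ge> 1 then M z else \<phi> z * mat_inv (P z))"

definition ext_plus ::
  "(complex \<Rightarrow> complex mat) \<Rightarrow> (complex \<Rightarrow> complex mat) \<Rightarrow> (complex \<Rightarrow> complex mat)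
    \<Rightarrow> complex \<Rightarrow> complex mat" where
  "ext_plus \<phi> M P z = (if norm z \<le> 1 then P z else mat_inv (M z) * \<phi> z)"

end

(* Telescoping the refactorization gives Phi^(kN) = G B, where G is the product of all phi^g factors
   split off on the left and B the product of all phi^b factors. G is invertible outside the open
   unit disc including infinity, because switching keeps each product of betas below 1. A product
   of kNl factors phi^b has a pole of order at most lN at 0, so z^(lN) B is entire. Hence
   z^(lN) B P^(-1) on the disc and G^(-1) z^(lN) M outside glue along the unit circle to a bounded
   entire function, whose constant value G(infinity)^(-1) is C^(-1). *)

theory Submission
  imports "HOL-Complex_Analysis.Conformal_Mappings" Defs
begin

text \<open>A factor \<open>phi_g\<close> breaks down at z = 0 and at one further point, the product
  of its k parameters. The switching ratio has the form X_i / X_(i-1), so its cyclic product is 1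
  and that point survives every switch. All stages of the recursion thus share one finite set
  \<open>S\<close> of bad points, contained in (0, 1). G is a product of inverses, but its inverse H
  is polynomial in u = 1/z. Working with H makes infinity the ordinary point u = 0, where every
  factor of H is unit lower triangular; this is why H(0) is invertible. The exponent kN is a
  multiple of k because 1/z enters only when the cycle of k indices wraps around: k factors
  \<open>phi_b\<close> cost at most one pole, and kNl of them cost lN, which balances the
  normalization z^(-lN) of M. Gluing compares B with P on the closed disc and G with M on the closed
  exterior. Multiplying back with \<phi> = G B = M P moves each identity to the other side, where
  \<open>ext_plus\<close> and \<open>ext_minus\<close> are defined through \<phi>.\<close>

unbundle no vec_syntax

text \<open>Liouville's theorem is applied after pulling back along \<open>w \<mapsto> exp (\<i> w)\<close>: this straightens the
  circle into the real line, across which a continuous piecewise holomorphic function is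
  holomorphic.\<close>

lemma constant_if_glued_along_unit_circle:
  fixes f g :: "complex \<Rightarrow> complex"
  assumes holf: "f holomorphic_on ball 0 1" and contf: "continuous_on (cball 0 1) f"
    and holg: "g holomorphic_on - cball 0 1" and contg: "continuous_on (- ball 0 1) g"
    and eq: "\<And>z. z \<in> sphere 0 1 \<Longrightarrow> f z = g z"
    and lim: "(g \<longlongrightarrow> L) at_infinity"
  shows "z \<in> cball 0 1 \<Longrightarrow> f z = L" and "z \<in> - ball 0 1 \<Longrightarrow> g z = L"
proof -
  define h where "h z = (if z \<in> cball 0 1 then f z else g z)" for z
  have h_in: "h z = f z" if "z \<in> cball 0 1" for z using that by (simp add: h_def)
  have h_out: "h z = g z" if "z \<in> - ball 0 1" for z
    using that eq[of z] by (auto simp: h_def)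
  have "continuous_on (cball 0 1 \<union> - ball 0 1) h"
    using contf contg h_in h_out
    by (intro continuous_on_closed_Un)
       (auto simp: closed_Compl intro: continuous_on_eq)
  moreover have "cball 0 1 \<union> - ball 0 1 = (UNIV :: complex set)" by auto
  ultimately have conth: "continuous_on UNIV h" by simp
  have holh1: "h holomorphic_on ball 0 1"
    using holf by (rule holomorphic_transform) (simp add: h_in)
  have holh2: "h holomorphic_on - cball 0 1"
    using holg by (rule holomorphic_transform) (simp add: h_out)
  have at_inf: "\<forall>\<^sub>F z in at_infinity. h z = g z"
    unfolding eventually_at_infinity by (rule exI[of _ 1]) (auto intro: h_out)
  then have limh: "(h \<longlongrightarrow> L) at_infinity"
    using lim by (simp add: tendsto_cong)
  then have "\<exists>B. \<forall>z. norm z \<ge> B \<longrightarrow> dist (h z) L < 1"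
    by (simp add: Lim_at_infinity)
  then obtain B where B: "\<And>z. norm z \<ge> B \<Longrightarrow> dist (h z) L < 1" by metis
  have "bounded (h ` (cball 0 B))"
    using conth by (intro compact_imp_bounded compact_continuous_image)
      (auto intro: continuous_on_subset)
  moreover have "range h \<subseteq> h ` (cball 0 B) \<union> ball L 1"
  proof
    fix y assume "y \<in> range h"
    then obtain z where z: "y = h z" by blast
    then show "y \<in> h ` (cball 0 B) \<union> ball L 1"
      using B[of z] by (cases "norm z \<le> B") (auto simp: dist_commute)
  qed
  ultimately have bh: "bounded (range h)"
    by (meson bounded_Un bounded_ball bounded_subset)
  define F where "F w = h (exp (\<i> * w))" for w
  have F: "F = h \<circ> (\<lambda>w. exp (\<i> * w))" by (auto simp: F_def)
  have "F holomorphic_on UNIV"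
  \<comment> \<open>The normal -i gives inner (-i) z = - Im z, and the modulus of exp (i z) is exp
    (- Im z): the negative side is the upper half plane, which maps into the open disc.\<close>
  proof (rule holomorphic_on_paste_across_line[of UNIV "- \<i>" F 0])
    show "F holomorphic_on UNIV \<inter> {z. inner (- \<i>) z < 0}"
      unfolding F by (intro holomorphic_on_compose_gen[OF _ holh1] holomorphic_intros)
        (auto simp: inner_complex_def)
    show "F holomorphic_on UNIV \<inter> {z. 0 < inner (- \<i>) z}"
      unfolding F by (intro holomorphic_on_compose_gen[OF _ holh2] holomorphic_intros)
        (auto simp: inner_complex_def)
    show "continuous_on UNIV F"
      unfolding F_def by (intro continuous_on_compose2[OF conth] continuous_intros) auto
  qed auto
  moreover have "bounded (range F)"
    using bh by (rule bounded_subset) (auto simp: F_def)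
  ultimately obtain c where c: "\<And>w. F w = c"
    using Liouville_theorem unfolding constant_on_def by blast
  \<comment> \<open>The exponential omits only 0; the value there is recovered below by
    continuity.\<close>
  have hc: "h z = c" if "z \<noteq> 0" for z
    using c[of "- \<i> * Ln z"] that by (simp add: F_def)
  then have "\<forall>\<^sub>F z in at_infinity. h z = c"
    unfolding eventually_at_infinity by (intro exI[of _ 1] allI impI hc) auto
  then have "(h \<longlongrightarrow> c) at_infinity" by (rule tendsto_eventually)
  then have cL: "c = L" using limh tendsto_unique trivial_limit_at_infinity by blast
  have "(h \<longlongrightarrow> h 0) (at 0)" using conth by (simp add: continuous_on_def)
  moreover have "(h \<longlongrightarrow> c) (at 0)"
    by (rule tendsto_eventually) (auto simp: eventually_at_filter hc)
  ultimately have "h 0 = c" using tendsto_unique trivial_limit_at by blast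
  with hc cL have "h z = L" for z by metis
  then show "z \<in> cball 0 1 \<Longrightarrow> f z = L" "z \<in> - ball 0 1 \<Longrightarrow> g z = L"
    using h_in h_out by metis+
qed

section \<open>Invertibility, determinants and \<open>mat_inv\<close>\<close>

lemma det_nonzero_if_invertible_mat:
  fixes A :: "complex mat"
  assumes "invertible_mat A" and A: "A \<in> carrier_mat n n"
  shows "det A \<noteq> 0"
proof -
  obtain B where AB: "A * B = 1\<^sub>m n" and BA: "B * A = 1\<^sub>m (dim_row B)"
    using assms unfolding invertible_mat_def inverts_mat_def by auto
  \<comment> \<open>\<open>invertible_mat\<close> does not fix the shape of the inverse; counting
    columns in both identities does.\<close>
  have "B \<in> carrier_mat n n"
    using arg_cong[OF AB, of dim_col] arg_cong[OF BA, of dim_col] A by auto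
  with A AB have "det A * det B = 1" by (metis det_mult det_one)
  then show ?thesis by auto
qed

lemma mat_inv:
  assumes A: "A \<in> carrier_mat n n" and "det A \<noteq> 0"
  shows "mat_inv A \<in> carrier_mat n n" "A * mat_inv A = 1\<^sub>m n" "mat_inv A * A = 1\<^sub>m n"
proof -
  have "A \<in> Units (ring_mat TYPE(complex) n undefined)"
    using det_non_zero_imp_unit[OF assms] .
  then obtain B where "mat_inverse A = Some B"
    using mat_inverse(1)[OF A, of undefined] by (cases "mat_inverse A") auto
  with mat_inverse(2)[OF A this]
  show "mat_inv A \<in> carrier_mat n n" "A * mat_inv A = 1\<^sub>m n" "mat_inv A * A = 1\<^sub>m n"
    by (simp_all add: mat_inv_def)
qed

lemma invertible_matI:
  fixes A :: "'a::semiring_1 mat"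
  assumes "A \<in> carrier_mat n n" "B \<in> carrier_mat n n" "A * B = 1\<^sub>m n" "B * A = 1\<^sub>m n"
  shows "invertible_mat A"
  using assms unfolding invertible_mat_def inverts_mat_def by auto

section \<open>The factors and the switching rule\<close>

text \<open>\<open>phi_b\<close> in terms of \<open>u = 1 / z\<close>, which makes sense also at \<open>z = \<infinity>\<close>.\<close>

definition phi_u :: "nat \<Rightarrow> complex \<Rightarrow> (nat \<Rightarrow> complex) \<Rightarrow> (nat \<Rightarrow> complex) \<Rightarrow> complex mat" where
  "phi_u k u a c = mat k k (\<lambda>(r, s). (if r = s then c s else 0)
     + (if r = (s + 1) mod k then a s * (if s + 1 < k then 1 else u) else 0))"

lemma phi_u_carrier [simp]: "phi_u k u a c \<in> carrier_mat k k"
  by (simp add: phi_u_def)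

text \<open>Subdiagonal and corner form a single cyclic off-diagonal r = s + 1 mod k, and 1/z sits
  on the step that wraps around.\<close>

lemma phi_b_eq_phi_u: "phi_b k z a c = phi_u k (1 / z) a c"
proof (rule eq_matI)
  fix r s assume "r < dim_row (phi_u k (1 / z) a c)" "s < dim_col (phi_u k (1 / z) a c)"
  then have r: "r < k" and s: "s < k" by (simp_all add: phi_u_def)
  show "phi_b k z a c $$ (r, s) = phi_u k (1 / z) a c $$ (r, s)"
  proof (cases "s + 1 < k")
    case True
    then have "s \<noteq> k - 1" by simp
    with True show ?thesis using r s by (simp add: phi_b_def phi_u_def)
  next
    case False
    with s have "s = k - 1" "Suc (k - Suc 0) = k" "k - Suc 0 < k" by simp_all
    then show ?thesis using r by (simp add: phi_b_def phi_u_def)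
  qed
qed (simp_all add: phi_b_def phi_u_def)

text \<open>Column s of \<open>phi_u\<close> is supported on the rows s and s + 1 mod k. For k = 1
  these coincide and the two contributions add up, so no case distinction arises.\<close>

lemma index_mult_phi_u:
  assumes A: "A \<in> carrier_mat n k" and r: "r < n" and s: "s < k"
  shows "(A * phi_u k u a c) $$ (r, s)
    = A $$ (r, s) * c s + A $$ (r, (s + 1) mod k) * (a s * (if s + 1 < k then 1 else u))"
proof -
  have "(s + 1) mod k < k" using s by simp
  have "(A * phi_u k u a c) $$ (r, s) = (\<Sum>t\<in>{0..<k}. A $$ (r, t) * phi_u k u a c $$ (t, s))"
    using A r s by (simp add: scalar_prod_def phi_u_def)
  also have "\<dots> = (\<Sum>t\<in>{0..<k}. (if t = s then A $$ (r, t) * c s else 0)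
      + (if t = (s + 1) mod k then A $$ (r, t) * (a s * (if s + 1 < k then 1 else u)) else 0))"
    using s by (intro sum.cong refl) (simp add: phi_u_def distrib_left)
  finally show ?thesis
    using s \<open>(s + 1) mod k < k\<close> by (simp add: sum.distrib)
qed

text \<open>The switching rule with the inverses cleared. Both products live on the cyclic diagonals
  of offset 0, 1 and 2: offset 0 agrees automatically, offset 1 is the hypothesis \<open>c\<close>,
  and offset 2 is the hypothesis \<open>a'\<close>.\<close>

lemma phi_u_commute:
  assumes a': "\<And>i. i < k \<Longrightarrow> b' ((i + 1) mod k) * a i = a' ((i + 1) mod k) * b i"
    and c: "\<And>i. i < k \<Longrightarrow> a' i + c i * b' i = a i + c ((i + 1) mod k) * b i"
  shows "phi_u k u (\<lambda>i. - b' i) (\<lambda>_. 1) * phi_u k u a c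
    = phi_u k u a' c * phi_u k u (\<lambda>i. - b i) (\<lambda>_. 1)" (is "?L = ?R")
proof (rule eq_matI)
  fix r s assume "r < dim_row ?R" "s < dim_col ?R"
  then have r: "r < k" and s: "s < k" by (simp_all add: phi_u_def)
  define t t' where "t = (s + 1) mod k" and "t' = (t + 1) mod k"
  have t: "t < k" and t': "t' < k" using s by (simp_all add: t_def t'_def)
  define x where "x i = (if i + 1 < k then 1 else u)" for i
  have 1: "b' t * a s = a' t * b s" and 2: "a' s = a s + c t * b s - c s * b' s"
    using a'[OF s] c[OF s] by (simp_all add: t_def algebra_simps)
  have e: "phi_u k u p q $$ (i, j) = (if i = j then q j else 0)
     + (if i = (j + 1) mod k then p j * x j else 0)" if "i < k" "j < k" for p q i j
    using that by (simp add: phi_u_def x_def)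
  have m: "(phi_u k u p q * phi_u k u p' q') $$ (r, s) =
    phi_u k u p q $$ (r, s) * q' s + phi_u k u p q $$ (r, t) * (p' s * x s)" for p q p' q'
    unfolding t_def x_def by (rule index_mult_phi_u[OF phi_u_carrier r s])
  have 3: "b' t * (a s * w) = a' t * (b s * w)" for w
    using 1 by (metis mult.assoc)
  have L: "?L $$ (r, s) = ((if r = s then 1 else 0) + (if r = t then - b' s * x s else 0)) * c s
      + ((if r = t then 1 else 0) + (if r = t' then - b' t * x t else 0)) * (a s * x s)"
    unfolding m e[OF r s] e[OF r t] t_def[symmetric] t'_def[symmetric] by simp
  have R: "?R $$ (r, s) = ((if r = s then c s else 0) + (if r = t then a' s * x s else 0))
      + ((if r = t then c t else 0) + (if r = t' then a' t * x t else 0)) * (- b s * x s)"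
    unfolding m e[OF r s] e[OF r t] t_def[symmetric] t'_def[symmetric] by simp
  have 4: "(if r = t' then - b' t * x t else 0) * (a s * x s)
      = (if r = t' then a' t * x t else 0) * (- b s * x s)"
    using 3[of "x s * x t"] by (simp add: algebra_simps)
  show "?L $$ (r, s) = ?R $$ (r, s)"
    unfolding L R distrib_right 4 2 by (auto simp: algebra_simps)
qed (simp_all add: phi_u_def)

text \<open>A left null vector satisfies \<open>v\<^sub>s = b\<^sub>s v\<^sub>s\<^sub>+\<^sub>1\<close>, so going once around the cycle multiplies it by
  \<open>u\<close> times the product of the \<open>b\<^sub>i\<close>.\<close>

lemma det_phi_u_eq_0_iff:
  assumes k: "k \<ge> 1"
  shows "det (phi_u k u (\<lambda>i. - b i) (\<lambda>_. 1)) = 0 \<longleftrightarrow> u * (\<Prod>i<k. b i) = 1"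
proof -
  let ?A = "phi_u k u (\<lambda>i. - b i) (\<lambda>_. 1)"
  define x where "x i = (if i + 1 < k then 1 else u)" for i
  have A: "transpose_mat ?A \<in> carrier_mat k k" by simp
  have ker: "transpose_mat ?A *\<^sub>v v = 0\<^sub>v k
      \<longleftrightarrow> (\<forall>s<k. v $ s = v $ ((s + 1) mod k) * (b s * x s))" if v: "v \<in> carrier_vec k" for v
  proof -
    have "(transpose_mat ?A *\<^sub>v v) $ s = v $ s - v $ ((s + 1) mod k) * (b s * x s)"
      if s: "s < k" for s
    proof -
      have "(transpose_mat ?A *\<^sub>v v) $ s = (mat_of_row v * ?A) $$ (0, s)"
        using v s by (simp add: scalar_prod_def phi_u_def mult.commute)
      also have "\<dots> = v $ s - v $ ((s + 1) mod k) * (b s * x s)"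
        using v s index_mult_phi_u[of "mat_of_row v" 1 k 0 s u "\<lambda>i. - b i" "\<lambda>_. 1"]
        by (simp add: x_def)
      finally show ?thesis .
    qed
    then show ?thesis by (auto simp: vec_eq_iff phi_u_def)
  qed
  have pk: "(\<Prod>i<k. b i) = (\<Prod>i<k-1. b i) * b (k - 1)"
    using k by (cases k) (simp_all add: lessThan_Suc mult.commute)
  have "det ?A = 0 \<longleftrightarrow> (\<exists>v. v \<in> carrier_vec k \<and> v \<noteq> 0\<^sub>v k \<and> transpose_mat ?A *\<^sub>v v = 0\<^sub>v k)"
    using det_0_iff_vec_prod_zero_field[OF A] det_transpose[OF phi_u_carrier] by metis
  also have "\<dots> \<longleftrightarrow> u * (\<Prod>i<k. b i) = 1"
  proof
    assume "\<exists>v. v \<in> carrier_vec k \<and> v \<noteq> 0\<^sub>v k \<and> transpose_mat ?A *\<^sub>v v = 0\<^sub>v k"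
    then obtain v where v: "v \<in> carrier_vec k" "v \<noteq> 0\<^sub>v k"
      and ev: "\<And>s. s < k \<Longrightarrow> v $ s = v $ ((s + 1) mod k) * (b s * x s)"
      using ker by blast
    have step: "v $ s = v $ (s + 1) * b s" if "s + 1 < k" for s
      using ev[of s] that by (simp add: x_def)
    have v0: "v $ 0 = (\<Prod>i<m. b i) * v $ m" if "m < k" for m
      using that by (induction m) (simp_all add: step mult_ac)
    have vk: "v $ (k - 1) = v $ 0 * (b (k - 1) * u)"
      using ev[of "k - 1"] k by (simp add: x_def)
    have "v $ 0 = v $ 0 * (u * (\<Prod>i<k. b i))"
      using v0[of "k - 1"] k unfolding vk pk by (simp add: mult_ac)
    \<comment> \<open>If v_0 vanished, the wrap-around relation would give v_(k-1) = 0, and the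
      recursion would carry this down to every index.\<close>
    moreover have "v $ 0 \<noteq> 0"
    proof
      assume z: "v $ 0 = 0"
      have "v $ s = 0" if "s \<le> k - 1" for s
        using that
      proof (induction rule: inc_induct)
        case base
        show ?case using vk z by simp
      next
        case (step n)
        then show ?case using \<open>\<And>s. s + 1 < k \<Longrightarrow> v $ s = v $ (s + 1) * b s\<close>[of n] by simp
      qed
      with v k show False by (auto simp: vec_eq_iff)
    qed
    ultimately show "u * (\<Prod>i<k. b i) = 1" by (metis mult_cancel_left2)
  next
    assume u: "u * (\<Prod>i<k. b i) = 1"
    \<comment> \<open>The solution of the recursion normalized by v_(k-1) = 1, the empty
      product.\<close>
    let ?v = "vec k (\<lambda>s. \<Prod>i\<in>{s..<k-1}. b i)"
    have "?v $ s = ?v $ ((s + 1) mod k) * (b s * x s)" if s: "s < k" for s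
    proof (cases "s + 1 < k")
      case True
      then show ?thesis
        using prod.atLeast_Suc_lessThan[of s "k - 1" b] by (simp add: x_def mult.commute)
    next
      case False
      with s have "s + 1 = k" by simp
      then have "s = k - 1" "(s + 1) mod k = 0" "x s = u" by (simp, metis mod_self, simp add: x_def)
      moreover have "(\<Prod>i\<in>{0..<k-1}. b i) * (b (k - 1) * u) = 1"
        using u pk by (metis lessThan_atLeast0 mult.assoc mult.commute)
      ultimately show ?thesis using k by simp
    qed
    then have "transpose_mat ?A *\<^sub>v ?v = 0\<^sub>v k" using iffD2[OF ker[OF vec_carrier]] by blast
    moreover have "?v $ (k - 1) \<noteq> 0\<^sub>v k $ (k - 1)" using k by simp
    then have "?v \<noteq> 0\<^sub>v k" by metis
    ultimately show "\<exists>v. v \<in> carrier_vec k \<and> v \<noteq> 0\<^sub>v k \<and> transpose_mat ?A *\<^sub>v v = 0\<^sub>v k"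
      by (intro exI[of _ ?v]) simp
  qed
  finally show ?thesis .
qed

text \<open>\<open>S\<close> holds the admissible products of the parameters of a
  \<open>Gfac\<close>. By \<open>det_phi_u_eq_0_iff\<close> such a product is the nonzero z at which
  the matrix to be inverted is singular, so avoiding 0 and \<open>S\<close> makes all factors
  meaningful at once.\<close>

fun fac_ok :: "nat \<Rightarrow> real set \<Rightarrow> factor \<Rightarrow> bool" where
  "fac_ok k S (Bfac a c) \<longleftrightarrow> (\<forall>i<k. 0 < a i \<and> 0 < c i)"
| "fac_ok k S (Gfac b) \<longleftrightarrow> (\<forall>i<k. 0 < b i) \<and> (\<Prod>i<k. b i) \<in> S"

section \<open>Cyclic shifts and the switching ratio\<close>

lemma succ_pred_mod: "i < k \<Longrightarrow> ((i + k - 1) mod k + 1) mod k = i" for i k :: nat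
  by (cases i) (auto simp: mod_Suc)

lemma pred_succ_mod: "i < k \<Longrightarrow> ((i + 1) mod k + k - 1) mod k = i" for i k :: nat
  by (cases "Suc i = k") auto

lemma prod_pred_mod:
  fixes f :: "nat \<Rightarrow> 'a::comm_monoid_mult"
  assumes "k \<ge> 1"
  shows "(\<Prod>i<k. f ((i + k - 1) mod k)) = (\<Prod>i<k. f i)"
  by (rule prod.reindex_bij_witness[of _ "\<lambda>i. (i + 1) mod k" "\<lambda>i. (i + k - 1) mod k"])
    (use assms succ_pred_mod[of _ k] pred_succ_mod[of _ k] in auto)

context
  fixes k :: nat and a b c :: "nat \<Rightarrow> real"
  assumes pos: "\<And>i. i < k \<Longrightarrow> 0 < a i \<and> 0 < b i \<and> 0 < c i"
begin

text \<open>The numerator of the switching ratio at i, and equally its denominator at i + 1.\<close>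

private definition X where "X i = a i + c ((i + 1) mod k) * b i"

lemma X_pos: "i < k \<Longrightarrow> 0 < X i"
  using pos[of i] pos[of "(i + 1) mod k"] by (auto simp: X_def intro!: add_pos_pos mult_pos_pos)

lemma switch_ratio_eq: "i < k \<Longrightarrow> switch_ratio k a b c i = X i / X ((i + k - 1) mod k)"
  using succ_pred_mod[of i k] by (simp add: switch_ratio_def X_def Let_def)

lemma switch_ratio_pos: "i < k \<Longrightarrow> 0 < switch_ratio k a b c i"
  using X_pos[of i] X_pos[of "(i + k - 1) mod k"] by (simp add: switch_ratio_eq)

text \<open>Numerator and denominator are the same product up to a cyclic shift. This keeps the
  product of the parameters of each \<open>Gfac\<close>, hence its singular point.\<close>

lemma prod_switch_ratio:
  assumes "k \<ge> 1"
  shows "(\<Prod>i<k. switch_ratio k a b c i) = 1"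
proof -
  have "(\<Prod>i<k. switch_ratio k a b c i) = (\<Prod>i<k. X i) / (\<Prod>i<k. X ((i + k - 1) mod k))"
    by (simp add: switch_ratio_eq prod_dividef)
  moreover have "(\<Prod>i<k. X i) \<noteq> 0" using X_pos by force
  ultimately show ?thesis using prod_pred_mod[OF assms, of X] by simp
qed

text \<open>The offset 1 condition of \<open>phi_u_commute\<close>: the common factor on the left is
  X_(i-1), which cancels the denominator of the ratio.\<close>

lemma switch_ratio_sum:
  assumes i: "i < k"
  shows "a ((i + k - 1) mod k) * switch_ratio k a b c i
      + c i * (b ((i + k - 1) mod k) * switch_ratio k a b c i) = a i + c ((i + 1) mod k) * b i"
proof -
  let ?p = "(i + k - 1) mod k"
  have "a ?p + c i * b ?p = X ?p" using succ_pred_mod[OF i] by (simp add: X_def)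
  moreover have "X ?p * switch_ratio k a b c i = X i"
    using X_pos[of ?p] i by (simp add: switch_ratio_eq)
  moreover have "a ?p * switch_ratio k a b c i + c i * (b ?p * switch_ratio k a b c i)
      = (a ?p + c i * b ?p) * switch_ratio k a b c i"
    by (simp only: distrib_right mult.assoc)
  ultimately show ?thesis by (simp only: X_def)
qed

end

abbreviation switched :: "nat \<Rightarrow> (nat \<Rightarrow> real) \<Rightarrow> (nat \<Rightarrow> real) \<Rightarrow> (nat \<Rightarrow> real) \<Rightarrow> (nat \<Rightarrow> real) \<Rightarrow> nat \<Rightarrow> real" where
  "switched k a b c d \<equiv> \<lambda>i. d ((i + k - 1) mod k) * switch_ratio k a b c i"

lemma fac_ok_switched:
  assumes k: "k \<ge> 1" and ok: "fac_ok k S (Bfac a c)" "fac_ok k S (Gfac b)"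
  shows "fac_ok k S (Bfac (switched k a b c a) c)" "fac_ok k S (Gfac (switched k a b c b))"
proof -
  have pos: "\<And>i. i < k \<Longrightarrow> 0 < a i \<and> 0 < b i \<and> 0 < c i" using ok by auto
  have "(\<Prod>i<k. switched k a b c b i) = (\<Prod>i<k. b i)"
    using prod_switch_ratio[of k a b c, OF pos k] prod_pred_mod[OF k, of b]
    by (simp add: prod.distrib)
  then show "fac_ok k S (Bfac (switched k a b c a) c)" "fac_ok k S (Gfac (switched k a b c b))"
    using pos ok switch_ratio_pos[of k a b c, OF pos] k by auto
qed

text \<open>The count of \<open>Bfac\<close> entries is carried along because it determines how many
  factors each stage contributes to B, and so the order of the pole at 0.\<close>

lemma switch_preserves:
  assumes "(switch k)\<^sup>*\<^sup>* xs ys" "k \<ge> 1" "\<forall>f\<in>set xs. fac_ok k S f"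
  shows "(\<forall>f\<in>set ys. fac_ok k S f) \<and> length (filter is_Bfac ys) = length (filter is_Bfac xs)"
  using assms(1)
proof (induction rule: rtranclp_induct)
  case (step ys zs)
  from step.hyps(2) step.IH show ?case
  proof (cases rule: switch.cases)
    case (1 us a c b vs)
    with step.IH fac_ok_switched[OF \<open>k \<ge> 1\<close>, of S a c b] show ?thesis by auto
  qed
qed (use assms in simp)

lemma Gfac_mat:
  assumes k: "k \<ge> 1" and ok: "fac_ok k S (Gfac b)" and z: "z \<noteq> 0" "z \<notin> of_real ` S"
  defines "A \<equiv> phi_u k (1 / z) (\<lambda>i. - of_real (b i)) (\<lambda>_. 1)"
  shows "fac_mat k z (Gfac b) \<in> carrier_mat k k"
    "A * fac_mat k z (Gfac b) = 1\<^sub>m k" "fac_mat k z (Gfac b) * A = 1\<^sub>m k"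
proof -
  have "complex_of_real (\<Prod>i<k. b i) \<in> of_real ` S" using ok by (intro imageI) simp
  then have "(\<Prod>i<k. complex_of_real (b i)) \<noteq> z" using z by (metis of_real_prod)
  then have "1 / z * (\<Prod>i<k. of_real (b i)) \<noteq> 1" using z by (auto simp: field_simps)
  then have "det A \<noteq> 0" unfolding A_def by (subst det_phi_u_eq_0_iff[OF k])
  then show "fac_mat k z (Gfac b) \<in> carrier_mat k k"
    "A * fac_mat k z (Gfac b) = 1\<^sub>m k" "fac_mat k z (Gfac b) * A = 1\<^sub>m k"
    using mat_inv[of A k] by (simp_all add: A_def phi_g_def phi_b_eq_phi_u)
qed

lemma fac_mat_carrier:
  assumes "k \<ge> 1" "fac_ok k S f" "z \<noteq> 0" "z \<notin> of_real ` S"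
  shows "fac_mat k z f \<in> carrier_mat k k"
proof (cases f)
  case (Bfac a c)
  then show ?thesis by (simp add: phi_b_eq_phi_u)
next
  case (Gfac b)
  then show ?thesis using Gfac_mat(1) assms by metis
qed

section \<open>Products of factors under switching\<close>

lemma prod_mat_Nil [simp]: "prod_mat k z [] = 1\<^sub>m k"
  and prod_mat_Cons [simp]: "prod_mat k z (f # fs) = fac_mat k z f * prod_mat k z fs"
  by (simp_all add: prod_mat_def)

lemma prod_mat_carrier:
  assumes "\<And>f. f \<in> set fs \<Longrightarrow> fac_mat k z f \<in> carrier_mat k k"
  shows "prod_mat k z fs \<in> carrier_mat k k"
  using assms by (induction fs) (simp, fastforce)

lemma prod_mat_append:
  assumes "\<And>f. f \<in> set (fs @ gs) \<Longrightarrow> fac_mat k z f \<in> carrier_mat k k"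
  shows "prod_mat k z (fs @ gs) = prod_mat k z fs * prod_mat k z gs"
  using assms
proof (induction fs)
  case Nil
  then show ?case using prod_mat_carrier[of gs k z] by simp
next
  case (Cons f fs)
  have "prod_mat k z fs \<in> carrier_mat k k" "prod_mat k z gs \<in> carrier_mat k k"
    "fac_mat k z f \<in> carrier_mat k k"
    using Cons.prems by (auto intro!: prod_mat_carrier)
  then show ?case using Cons by (simp add: assoc_mult_mat[of _ k k _ k _ k])
qed

text \<open>Puts the inverses back: X' is cancelled on the left and X on the right, which leads from
  \<open>phi_u_commute\<close> to the switching rule.\<close>

lemma mult_mat_inverse_intertwine:
  fixes A :: "'a::semiring_1 mat"
  assumes car: "A \<in> carrier_mat n n" "A' \<in> carrier_mat n n" "X \<in> carrier_mat n n"
    "X' \<in> carrier_mat n n" "G \<in> carrier_mat n n" "G' \<in> carrier_mat n n"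
    and comm: "X' * A = A' * X" and inv: "X * G = 1\<^sub>m n" "G' * X' = 1\<^sub>m n"
  shows "A * G = G' * A'"
proof -
  have "A * G = (G' * X') * (A * G)"
    using car by (simp add: inv)
  also have "\<dots> = G' * ((X' * A) * G)"
    using car by (simp add: assoc_mult_mat[of _ n n _ n _ n])
  also have "\<dots> = G' * (A' * (X * G))"
    unfolding comm using car by (simp add: assoc_mult_mat[of _ n n _ n _ n])
  finally show ?thesis using car by (simp add: inv)
qed

lemma fac_mat_switch:
  assumes k: "k \<ge> 1" and ok: "fac_ok k S (Bfac a c)" "fac_ok k S (Gfac b)"
    and z: "z \<noteq> 0" "z \<notin> of_real ` S"
  shows "fac_mat k z (Bfac a c) * fac_mat k z (Gfac b)
    = fac_mat k z (Gfac (switched k a b c b)) * fac_mat k z (Bfac (switched k a b c a) c)"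
proof -
  have pos: "\<And>i. i < k \<Longrightarrow> 0 < a i \<and> 0 < b i \<and> 0 < c i" using ok by auto
  define a' b' where "a' = switched k a b c a" and "b' = switched k a b c b"
  let ?X = "phi_u k (1 / z) (\<lambda>i. - of_real (b i)) (\<lambda>_. 1)"
  let ?X' = "phi_u k (1 / z) (\<lambda>i. - of_real (b' i)) (\<lambda>_. 1)"
  let ?A = "phi_u k (1 / z) (\<lambda>i. of_real (a i)) (\<lambda>i. of_real (c i))"
  let ?A' = "phi_u k (1 / z) (\<lambda>i. of_real (a' i)) (\<lambda>i. of_real (c i))"
  let ?G = "fac_mat k z (Gfac b)"
  let ?G' = "fac_mat k z (Gfac b')"
  note G = Gfac_mat[OF k ok(2) z]
  have "fac_ok k S (Gfac b')" unfolding b'_def by (rule fac_ok_switched(2)[OF k ok])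
  note G' = Gfac_mat[OF k this z]
  have comm: "?X' * ?A = ?A' * ?X"
  proof (rule phi_u_commute)
    fix i assume i: "i < k"
    \<comment> \<open>Immediate, since a' and b' are the shifted a and b multiplied by the same
      ratio.\<close>
    have "b' ((i + 1) mod k) * a i = a' ((i + 1) mod k) * b i"
      unfolding a'_def b'_def pred_succ_mod[OF i] by simp
    then show "complex_of_real (b' ((i + 1) mod k)) * of_real (a i)
        = of_real (a' ((i + 1) mod k)) * of_real (b i)"
      by (metis of_real_mult)
    have "a' i + c i * b' i = a i + c ((i + 1) mod k) * b i"
      unfolding a'_def b'_def by (rule switch_ratio_sum[OF pos i])
    then show "complex_of_real (a' i) + of_real (c i) * of_real (b' i)
        = of_real (a i) + of_real (c ((i + 1) mod k)) * of_real (b i)"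
      by (metis of_real_mult of_real_add)
  qed
  have "?A * ?G = ?G' * ?A'"
    by (rule mult_mat_inverse_intertwine[OF _ _ _ _ G(1) G'(1) comm G(2) G'(3)]) simp_all
  then show ?thesis by (simp add: a'_def b'_def phi_b_eq_phi_u)
qed

lemma prod_mat_switch:
  assumes "(switch k)\<^sup>*\<^sup>* xs ys" "k \<ge> 1" "\<forall>f\<in>set xs. fac_ok k S f"
    and z: "z \<noteq> 0" "z \<notin> of_real ` S"
  shows "prod_mat k z ys = prod_mat k z xs"
  using assms(1)
proof (induction rule: rtranclp_induct)
  case (step ys zs)
  note ok = switch_preserves[OF step.hyps(1) assms(2,3), THEN conjunct1]
  from step.hyps(2) have "prod_mat k z zs = prod_mat k z ys"
  proof (cases rule: switch.cases)
    case (1 us a c b vs)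
    let ?B = "fac_mat k z (Bfac a c)" and ?G = "fac_mat k z (Gfac b)"
    let ?G' = "fac_mat k z (Gfac (switched k a b c b))"
    let ?B' = "fac_mat k z (Bfac (switched k a b c a) c)"
    let ?V = "prod_mat k z vs"
    have oks: "fac_ok k S (Bfac a c)" "fac_ok k S (Gfac b)" "\<forall>f\<in>set us. fac_ok k S f"
      "\<forall>f\<in>set vs. fac_ok k S f" using ok 1 by auto
    note oks' = fac_ok_switched[OF assms(2) oks(1,2)]
    have car: "?B \<in> carrier_mat k k" "?G \<in> carrier_mat k k" "?G' \<in> carrier_mat k k"
      "?B' \<in> carrier_mat k k" "?V \<in> carrier_mat k k"
      using oks oks' assms(2) z
      by (blast intro!: fac_mat_carrier[of k S] prod_mat_carrier)+
    have "?B * (?G * ?V) = ?G' * (?B' * ?V)"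
      using fac_mat_switch[OF assms(2) oks(1,2) z]
      unfolding assoc_mult_mat[OF car(1,2,5), symmetric] assoc_mult_mat[OF car(3,4,5), symmetric]
      by (rule arg_cong)
    moreover have "prod_mat k z ys = prod_mat k z us * (?B * (?G * ?V))"
      unfolding 1 using oks fac_mat_carrier[OF assms(2) _ z]
      by (subst prod_mat_append) (auto simp del: fac_ok.simps fac_mat.simps)
    moreover have "prod_mat k z zs = prod_mat k z us * (?G' * (?B' * ?V))"
      unfolding 1 using oks oks' fac_mat_carrier[OF assms(2) _ z]
      by (subst prod_mat_append) (auto simp del: fac_ok.simps fac_mat.simps)
    ultimately show ?thesis by simp
  qed
  with step.IH show ?case by simp
qed simp

section \<open>Powers of the symbol\<close>

lemma refactorization_switch:
  assumes "refactorization k fs F gs bs"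
  shows "(switch k)\<^sup>*\<^sup>* (F j) (gs j @ bs j)" "F (Suc j) = bs j @ gs j" "F 0 = fs"
    "f \<in> set (gs j) \<Longrightarrow> \<not> is_Bfac f" "f \<in> set (bs j) \<Longrightarrow> is_Bfac f"
  using assms by (simp_all add: refactorization_def)

text \<open>F (j + 1) lists the factors of \<open>gs j @ bs j\<close> in another order, and all
  \<open>Bfac\<close> entries of that list lie in \<open>bs j\<close>; so the invariants of
  switching pass from stage to stage.\<close>

lemma refactorization_preserves:
  assumes r: "refactorization k fs F gs bs" and k: "k \<ge> 1" and ok: "\<forall>f\<in>set fs. fac_ok k S f"
  shows "(\<forall>f\<in>set (gs j @ bs j). fac_ok k S f) \<and> length (bs j) = length (filter is_Bfac fs)"
    and "\<forall>f\<in>set (F j). fac_ok k S f"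
proof -
  have len: "length (filter is_Bfac (gs j @ bs j)) = length (bs j)" for j
    using refactorization_switch(4,5)[OF r, where j = j] by (simp add: filter_True filter_False)
  have sw: "(\<forall>f\<in>set (gs j @ bs j). fac_ok k S f)
      \<and> length (bs j) = length (filter is_Bfac (F j))"
    if "\<forall>f\<in>set (F j). fac_ok k S f" for j
    using switch_preserves[OF refactorization_switch(1)[OF r] k that] len by simp
  have "(\<forall>f\<in>set (F j). fac_ok k S f) \<and> length (filter is_Bfac (F j)) = length (filter is_Bfac fs)"
  proof (induction j)
    case 0
    then show ?case using ok refactorization_switch(3)[OF r] by simp
  next
    case (Suc j)
    with sw[of j] len[of j] show ?case
      unfolding refactorization_switch(2)[OF r] by (auto simp del: fac_ok.simps)
  qed
  with sw[of j] show "(\<forall>f\<in>set (gs j @ bs j). fac_ok k S f) \<and> length (bs j) = length (filter is_Bfac fs)"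
    "\<forall>f\<in>set (F j). fac_ok k S f" by simp_all
qed

lemma prod_mat_concat_carrier:
  assumes "\<And>j f. f \<in> set (hs j) \<Longrightarrow> fac_mat k z f \<in> carrier_mat k k"
  shows "prod_mat k z (concat (map hs js)) \<in> carrier_mat k k"
  using assms by (intro prod_mat_carrier) auto

text \<open>Iterating \<open>\<Phi>\<^sub>j\<^sub>+\<^sub>1 = (\<Phi>\<^sub>j)\<^sub>+ \<Phi>\<^sub>j (\<Phi>\<^sub>j)\<^sub>+\<^sup>-\<^sup>1\<close> telescopes the powers of \<open>\<Phi>\<^sub>0\<close>.\<close>

lemma refactorization_power:
  assumes r: "refactorization k fs F gs bs" and k: "k \<ge> 1" and ok: "\<forall>f\<in>set fs. fac_ok k S f"
    and z: "z \<noteq> 0" "z \<notin> of_real ` S"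
  shows "prod_mat k z fs ^\<^sub>m n
    = prod_mat k z (concat (map gs [0..<n])) * prod_mat k z (concat (map bs (rev [0..<n])))"
proof -
  have car: "fac_mat k z f \<in> carrier_mat k k" if "f \<in> set (gs j) \<or> f \<in> set (bs j)" for f j
    using refactorization_preserves(1)[OF r k ok] that by (intro fac_mat_carrier[OF k _ z]) auto
  have [simp]: "prod_mat k z (gs j) \<in> carrier_mat k k" "prod_mat k z (bs j) \<in> carrier_mat k k"
    "prod_mat k z (concat (map gs js)) \<in> carrier_mat k k"
    "prod_mat k z (concat (map bs js)) \<in> carrier_mat k k" for j js
    using car by (intro prod_mat_carrier prod_mat_concat_carrier; blast)+
  let ?G = "\<lambda>n. prod_mat k z (concat (map gs [0..<n]))"
  let ?B = "\<lambda>n. prod_mat k z (concat (map bs (rev [0..<n])))"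
  note assoc = assoc_mult_mat[of _ k k _ k _ k]
  have G: "?G (Suc n) = ?G n * prod_mat k z (gs n)" for n
    using car by (simp, subst prod_mat_append) auto
  have B: "?B (Suc n) = prod_mat k z (bs n) * ?B n" for n
    using car by (simp, subst prod_mat_append) auto
  have F: "prod_mat k z (F j) = prod_mat k z (gs j) * prod_mat k z (bs j)" for j
    using prod_mat_switch[OF refactorization_switch(1)[OF r] k
        refactorization_preserves(2)[OF r k ok] z] car
    by (subst (asm) prod_mat_append) auto
  have F': "prod_mat k z (F (Suc j)) = prod_mat k z (bs j) * prod_mat k z (gs j)" for j
    unfolding refactorization_switch(2)[OF r] using car by (subst prod_mat_append) auto
  have Fcar: "prod_mat k z (F j) \<in> carrier_mat k k" for j
    unfolding F by (rule mult_carrier_mat[of _ k k _ k]) simp_all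
  \<comment> \<open>The conjugation of \<Phi> into its n-th stage, written as an intertwining
    relation because B may be singular at some z.\<close>
  have BF: "?B n * prod_mat k z (F 0) = prod_mat k z (F n) * ?B n" for n
  proof (induction n)
    case 0
    show ?case using Fcar[of 0] by simp
  next
    case (Suc n)
    have "?B (Suc n) * prod_mat k z (F 0) = prod_mat k z (bs n) * (prod_mat k z (F n) * ?B n)"
      unfolding B Suc[symmetric] using Fcar by (simp add: assoc)
    also have "\<dots> = prod_mat k z (F (Suc n)) * ?B (Suc n)"
      unfolding B F' F[of n] by (simp add: assoc mult_carrier_mat[of _ k k _ k])
    finally show ?case .
  qed
  have "prod_mat k z (F 0) ^\<^sub>m n = ?G n * ?B n"
  proof (induction n)
    case 0
    show ?case using Fcar[of 0] by simp
  next
    case (Suc n)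
    have "prod_mat k z (F 0) ^\<^sub>m Suc n = ?G n * (?B n * prod_mat k z (F 0))"
      using Suc Fcar[of 0] by (simp add: assoc)
    also have "\<dots> = ?G (Suc n) * ?B (Suc n)"
      unfolding BF G B F[of n] by (simp add: assoc mult_carrier_mat[of _ k k _ k])
    finally show ?case .
  qed
  then show ?thesis by (simp add: refactorization_switch(3)[OF r])
qed

section \<open>Analyticity of the two products\<close>

lemma index_mult_mat_sum:
  assumes "A \<in> carrier_mat n m" "B \<in> carrier_mat m p" "i < n" "j < p"
  shows "(A * B) $$ (i, j) = (\<Sum>t<m. A $$ (i, t) * B $$ (t, j))"
  using assms by (simp add: scalar_prod_def lessThan_atLeast0)

text \<open>The inverse of a product of \<open>phi_g\<close> factors: the same factors uninverted
  and in reverse order. Being polynomial in u, it has a value at u = 0, that is at z = infinity. A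
  \<open>Bfac\<close> gets the identity as default value.\<close>

definition inv_prod_mat :: "nat \<Rightarrow> complex \<Rightarrow> factor list \<Rightarrow> complex mat" where
  "inv_prod_mat k u fs = foldr (\<lambda>f A. A * (case f of Gfac b \<Rightarrow>
     phi_u k u (\<lambda>i. - of_real (b i)) (\<lambda>_. 1) | Bfac a c \<Rightarrow> 1\<^sub>m k)) fs (1\<^sub>m k)"

lemma inv_prod_mat_simps [simp]:
  "inv_prod_mat k u [] = 1\<^sub>m k"
  "inv_prod_mat k u (Gfac b # fs)
    = inv_prod_mat k u fs * phi_u k u (\<lambda>i. - of_real (b i)) (\<lambda>_. 1)"
  by (simp_all add: inv_prod_mat_def)

lemma inv_prod_mat_carrier:
  "\<forall>f\<in>set fs. \<not> is_Bfac f \<Longrightarrow> inv_prod_mat k u fs \<in> carrier_mat k k"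
proof (induction fs)
  case (Cons f fs)
  then show ?case by (cases f) auto
qed simp

lemma inv_prod_mat_mult_prod_mat:
  assumes k: "k \<ge> 1" and z: "z \<noteq> 0" "z \<notin> of_real ` S"
    and "\<forall>f\<in>set fs. \<not> is_Bfac f \<and> fac_ok k S f"
  shows "inv_prod_mat k (1 / z) fs * prod_mat k z fs = 1\<^sub>m k"
  using assms(4)
proof (induction fs)
  case (Cons f fs)
  then obtain b where f: "f = Gfac b" and ok: "fac_ok k S (Gfac b)" by (cases f) auto
  let ?H = "inv_prod_mat k (1 / z) fs" and ?P = "prod_mat k z fs"
  let ?X = "phi_u k (1 / z) (\<lambda>i. - of_real (b i)) (\<lambda>_. 1)" and ?G = "fac_mat k z (Gfac b)"
  note G = Gfac_mat[OF k ok z]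
  have car: "?H \<in> carrier_mat k k" "?P \<in> carrier_mat k k"
    using Cons.prems fac_mat_carrier[OF k _ z]
    by (auto intro!: inv_prod_mat_carrier prod_mat_carrier)
  have "(?H * ?X) * (?G * ?P) = ?H * ((?X * ?G) * ?P)"
    using car G(1) by (simp add: assoc_mult_mat[of _ k k _ k _ k] del: fac_mat.simps)
  also have "\<dots> = 1\<^sub>m k" unfolding G(2) using car Cons by simp
  finally show ?case by (simp add: f)
qed simp

text \<open>At u = 0 the criterion \<open>det_phi_u_eq_0_iff\<close> for a singular factor reads 0 =
  1.\<close>

lemma det_inv_prod_mat_0:
  assumes k: "k \<ge> 1" and "\<forall>f\<in>set fs. \<not> is_Bfac f"
  shows "det (inv_prod_mat k 0 fs) \<noteq> 0"
  using assms(2)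
proof (induction fs)
  case (Cons f fs)
  then obtain b where f: "f = Gfac b" by (cases f) auto
  have "inv_prod_mat k 0 fs \<in> carrier_mat k k" using Cons.prems by (simp add: inv_prod_mat_carrier)
  from det_mult[OF this phi_u_carrier] Cons show ?case
    by (simp add: f det_phi_u_eq_0_iff[OF k])
qed simp

lemma inv_prod_mat_holomorphic:
  assumes "\<forall>f\<in>set fs. \<not> is_Bfac f" "i < k" "j < k"
  shows "(\<lambda>u. inv_prod_mat k u fs $$ (i, j)) holomorphic_on A"
  using assms
proof (induction fs arbitrary: i j)
  case (Cons f fs)
  then obtain b where f: "f = Gfac b" by (cases f) auto
  have "inv_prod_mat k u fs \<in> carrier_mat k k" for u
    using Cons.prems by (simp add: inv_prod_mat_carrier)
  note eq = index_mult_phi_u[OF this \<open>i < k\<close> \<open>j < k\<close>]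
  have "(j + 1) mod k < k" using \<open>j < k\<close> by simp
  then show ?case
    unfolding f inv_prod_mat_simps eq using Cons
    by (cases "j + 1 < k") (auto intro!: holomorphic_intros)
qed simp

text \<open>An entry \<open>(r, s)\<close> is a sum over cyclic paths from \<open>s\<close> to \<open>r\<close>, and each passage from
  \<open>k - 1\<close> to \<open>0\<close> contributes a pole of order one. The induction passes from \<open>q\<close>
  to \<open>q - 1\<close>, hence has to reach \<open>q = 0\<close>, where no path exists; this is why the bound is stated
  with an extra factor \<open>z\<close>.\<close>

lemma Bfac_prod_mat_pole_order:
  assumes "\<forall>f\<in>set fs. is_Bfac f" "r < k" "s < k" "s + length fs < k * q + r"
  shows "\<exists>p. p holomorphic_on UNIV \<and> (\<forall>z. z \<noteq> 0 \<longrightarrow> z ^ q * prod_mat k z fs $$ (r, s) = z * p z)"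
  using assms
proof (induction fs arbitrary: s q rule: rev_induct)
  case Nil
  show ?case
  proof (cases "r = s")
    \<comment> \<open>Here the length bound forces q > 0, so one power of z is available for the
      extra factor.\<close>
    case True
    then obtain q' where "q = Suc q'" using Nil by (cases q) auto
    then show ?thesis
      using Nil True by (intro exI[of _ "\<lambda>z. z ^ q'"]) (auto intro!: holomorphic_intros)
  next
    case False
    then show ?thesis using Nil by (intro exI[of _ "\<lambda>_. 0"]) auto
  qed
next
  case (snoc f fs)
  then obtain a c where f: "f = Bfac a c" by (cases f) auto
  have car: "fac_mat k z g \<in> carrier_mat k k" if "g \<in> set (fs @ [f])" for g z
    using snoc.prems(1) that by (cases g) (auto simp: phi_b_eq_phi_u)
  have "prod_mat k z (fs @ [f]) = prod_mat k z fs
      * phi_u k (1 / z) (\<lambda>i. of_real (a i)) (\<lambda>i. of_real (c i))" for z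
    using car[of _ z] by (subst prod_mat_append) (auto simp: f phi_b_eq_phi_u right_mult_one_mat[of _ k k])
  moreover have "prod_mat k z fs \<in> carrier_mat k k" for z
    using car by (intro prod_mat_carrier) simp
  ultimately have e: "prod_mat k z (fs @ [f]) $$ (r, s) = prod_mat k z fs $$ (r, s) * of_real (c s)
      + prod_mat k z fs $$ (r, (s + 1) mod k) * (of_real (a s) * (if s + 1 < k then 1 else 1 / z))"
    for z
    using index_mult_phi_u[OF _ \<open>r < k\<close> \<open>s < k\<close>] by metis
  obtain p1 where p1: "p1 holomorphic_on UNIV"
    "\<And>z. z \<noteq> 0 \<Longrightarrow> z ^ q * prod_mat k z fs $$ (r, s) = z * p1 z"
    using snoc.IH[of s q] snoc.prems by auto
  have "\<exists>p2. p2 holomorphic_on UNIV \<and> (\<forall>z. z \<noteq> 0 \<longrightarrow> z ^ q * (prod_mat k z fs $$ (r, (s + 1) mod k)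
      * (if s + 1 < k then 1 else 1 / z)) = z * p2 z)"
  proof (cases "s + 1 < k")
    case True
    then show ?thesis using snoc.IH[of "s + 1" q] snoc.prems by simp
  next
    \<comment> \<open>The wrap-around: the column index drops from k to 0 and q by one, which leaves
      the length bound intact, and 1/z absorbs the released power of z. The case q = 0 is excluded
      by r < k.\<close>
    case False
    with snoc.prems have s: "s + 1 = k" by simp
    with snoc.prems obtain q' where q: "q = Suc q'" by (cases q) auto
    have "0 + length fs < k * q' + r" using snoc.prems s q by simp
    with snoc.IH[of 0 q'] snoc.prems obtain p where "p holomorphic_on UNIV"
      "\<And>z. z \<noteq> 0 \<Longrightarrow> z ^ q' * prod_mat k z fs $$ (r, 0) = z * p z" by auto
    with False s show ?thesis by (intro exI[of _ p]) (simp add: q)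
  qed
  then obtain p2 where p2: "p2 holomorphic_on UNIV"
    "\<And>z. z \<noteq> 0 \<Longrightarrow> z ^ q * (prod_mat k z fs $$ (r, (s + 1) mod k)
      * (if s + 1 < k then 1 else 1 / z)) = z * p2 z" by blast
  show ?case
  proof (intro exI[of _ "\<lambda>z. p1 z * of_real (c s) + p2 z * of_real (a s)"] conjI allI impI)
    show "(\<lambda>z. p1 z * of_real (c s) + p2 z * of_real (a s)) holomorphic_on UNIV"
      using p1 p2 by (intro holomorphic_intros)
  next
    fix z :: complex assume "z \<noteq> 0"
    have "z ^ q * prod_mat k z (fs @ [f]) $$ (r, s)
      = (z ^ q * prod_mat k z fs $$ (r, s)) * of_real (c s)
      + (z ^ q * (prod_mat k z fs $$ (r, (s + 1) mod k) * (if s + 1 < k then 1 else 1 / z))) * of_real (a s)"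
      unfolding e by (simp only: distrib_left mult_ac)
    also have "\<dots> = z * (p1 z * of_real (c s) + p2 z * of_real (a s))"
      unfolding p1(2)[OF \<open>z \<noteq> 0\<close>] p2(2)[OF \<open>z \<noteq> 0\<close>] by (simp only: distrib_left mult.assoc)
    finally show "z ^ q * prod_mat k z (fs @ [f]) $$ (r, s)
      = z * (p1 z * of_real (c s) + p2 z * of_real (a s))" .
  qed
qed

section \<open>Comparison with the Wiener--Hopf factorization\<close>

lemma mat_analytic_on_imp_holomorphic:
  "mat_analytic_on k A S \<Longrightarrow> i < k \<Longrightarrow> j < k \<Longrightarrow> (\<lambda>z. A z $$ (i, j)) holomorphic_on S"
  by (simp add: mat_analytic_on_def analytic_imp_holomorphic)

text \<open>Here H plays the inverse of G as a function of 1/z, and Q plays z^m B. On the circle Q =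
  H z^m M P, so the two expressions in the conclusion agree there, and scalar gluing applies to each
  entry.\<close>

lemma wiener_hopf_eq_constant:
  assumes wh: "wiener_hopf k m \<phi> M P"
    and Q: "\<And>z. Q z \<in> carrier_mat k k"
      "\<And>i j. i < k \<Longrightarrow> j < k \<Longrightarrow> (\<lambda>z. Q z $$ (i, j)) holomorphic_on UNIV"
    and H: "\<And>u. H u \<in> carrier_mat k k"
      "\<And>i j. i < k \<Longrightarrow> j < k \<Longrightarrow> (\<lambda>u. H u $$ (i, j)) holomorphic_on UNIV"
    and eq: "\<And>z. z \<in> sphere 0 1 \<Longrightarrow> H (1 / z) * (z ^ m \<cdot>\<^sub>m \<phi> z) = Q z"
  shows "z \<in> cball 0 1 \<Longrightarrow> Q z * mat_inv (P z) = H 0"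
    and "z \<in> - ball 0 1 \<Longrightarrow> H (1 / z) * (z ^ m \<cdot>\<^sub>m M z) = H 0"
proof -
  have P: "P z \<in> carrier_mat k k" "det (P z) \<noteq> 0" if "z \<in> cball 0 1" for z
    using wh that by (auto simp: wiener_hopf_def dest: det_nonzero_if_invertible_mat)
  have Pinv: "mat_inv (P z) \<in> carrier_mat k k" "P z * mat_inv (P z) = 1\<^sub>m k"
    if "z \<in> cball 0 1" for z
    using mat_inv[OF P[OF that]] by simp_all
  have M: "M z \<in> carrier_mat k k" if "z \<in> - ball 0 1" for z
    using wh that by (simp add: wiener_hopf_def)
  \<comment> \<open>Entries as explicit scalar sums, to which the closure rules for holomorphic and
    continuous functions apply.\<close>
  define f g where "f i j z = (\<Sum>t<k. Q z $$ (i, t) * mat_inv (P z) $$ (t, j))"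
    and "g i j z = (\<Sum>t<k. H (1 / z) $$ (i, t) * (z ^ m * M z $$ (t, j)))" for i j z
  have f: "(Q z * mat_inv (P z)) $$ (i, j) = f i j z"
    if "z \<in> cball 0 1" "i < k" "j < k" for i j z
    using index_mult_mat_sum[OF Q(1) Pinv(1)] that by (simp add: f_def)
  have g: "(H (1 / z) * (z ^ m \<cdot>\<^sub>m M z)) $$ (i, j) = g i j z"
    if "z \<in> - ball 0 1" "i < k" "j < k" for i j z
    using index_mult_mat_sum[OF H(1), of "z ^ m \<cdot>\<^sub>m M z" k i j] M[OF that(1)] that
    by (simp add: g_def)
  have "(\<forall>z\<in>cball 0 1. f i j z = H 0 $$ (i, j)) \<and> (\<forall>z\<in>- ball 0 1. g i j z = H 0 $$ (i, j))"
    if ij: "i < k" "j < k" for i j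
  proof -
    have Hinv: "(\<lambda>z. H (1 / z) $$ (i, t)) holomorphic_on - {0}" if "t < k" for t
    proof -
      have "(\<lambda>z::complex. 1 / z) holomorphic_on - {0}" by (intro holomorphic_intros) simp
      from holomorphic_on_compose_gen[OF this H(2)[OF \<open>i < k\<close> that]] show ?thesis
        by (simp add: o_def)
    qed
    have *: "f i j holomorphic_on ball 0 1"
      unfolding f_def using wh ij
      by (intro holomorphic_intros mat_analytic_on_imp_holomorphic[of k "\<lambda>z. mat_inv (P z)"])
         (auto simp: wiener_hopf_def intro: holomorphic_on_subset[OF Q(2)])
    have "continuous_on (cball 0 1) (f i j)"
      unfolding f_def using wh ij
      by (intro continuous_intros)
         (auto simp: wiener_hopf_def mat_continuous_on_def
            intro: continuous_on_subset[OF holomorphic_on_imp_continuous_on[OF Q(2)]])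
    \<comment> \<open>The collected facts follow the order of the hypotheses of
      \<open>constant_if_glued_along_unit_circle\<close>.\<close>
    note * = * this
    have "g i j holomorphic_on - cball 0 1"
      unfolding g_def using wh ij
      by (intro holomorphic_intros mat_analytic_on_imp_holomorphic[of k M])
         (auto simp: wiener_hopf_def intro: holomorphic_on_subset[OF Hinv])
    note * = * this
    have "continuous_on (- ball 0 1) (g i j)"
      unfolding g_def using wh ij
      by (intro continuous_intros)
         (auto simp: wiener_hopf_def mat_continuous_on_def
            intro: continuous_on_subset[OF holomorphic_on_imp_continuous_on[OF Hinv]])
    note * = * this
    have "f i j z = g i j z" if z: "z \<in> sphere 0 1" for z
    proof -
      have z': "z \<in> cball 0 1" "z \<in> - ball 0 1" using z by auto
      have \<phi>: "\<phi> z = M z * P z" using wh z by (simp add: wiener_hopf_def)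
      let ?X = "H (1 / z) * (z ^ m \<cdot>\<^sub>m M z)"
      have X: "?X \<in> carrier_mat k k" using H(1) M[OF z'(2)] by (intro mult_carrier_mat[of _ k k]) auto
      have "Q z = ?X * P z"
        unfolding eq[OF z, symmetric] \<phi>
        using H(1) M[OF z'(2)] P(1)[OF z'(1)]
        by (simp add: mult_smult_assoc_mat[of _ k k _ k] assoc_mult_mat[of _ k k _ k _ k])
      then have "Q z * mat_inv (P z) = ?X * (P z * mat_inv (P z))"
        using assoc_mult_mat[OF X P(1)[OF z'(1)] Pinv(1)[OF z'(1)]] by simp
      also have "\<dots> = ?X"
        unfolding Pinv(2)[OF z'(1)] using X by (rule right_mult_one_mat)
      finally show ?thesis using f g z' ij by metis
    qed
    note * = * this
    \<comment> \<open>H (1/z) tends to H 0 and z^m M to the identity, which identifies the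
      constant.\<close>
    have "(g i j \<longlongrightarrow> (\<Sum>t<k. H 0 $$ (i, t) * 1\<^sub>m k $$ (t, j))) at_infinity"
      unfolding g_def
    proof (intro tendsto_sum tendsto_mult)
      fix t assume t: "t \<in> {..<k}"
      have "((\<lambda>z::complex. 1 / z) \<longlongrightarrow> 0) at_infinity"
        unfolding divide_inverse mult_1_left by (rule tendsto_inverse_0)
      moreover have "isCont (\<lambda>u. H u $$ (i, t)) 0"
        using holomorphic_on_imp_continuous_on[OF H(2)[OF \<open>i < k\<close>, of t]] t
        by (simp add: continuous_on_eq_continuous_at)
      ultimately show "((\<lambda>z. H (1 / z) $$ (i, t)) \<longlongrightarrow> H 0 $$ (i, t)) at_infinity"
        by (rule isCont_tendsto_compose[rotated])
      show "((\<lambda>z. z ^ m * M z $$ (t, j)) \<longlongrightarrow> 1\<^sub>m k $$ (t, j)) at_infinity"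
        using wh t ij by (simp add: wiener_hopf_def)
    qed
    also have "(\<Sum>t<k. H 0 $$ (i, t) * 1\<^sub>m k $$ (t, j)) = (H 0 * 1\<^sub>m k) $$ (i, j)"
      using index_mult_mat_sum[OF H(1) one_carrier_mat ij] by simp
    also have "\<dots> = H 0 $$ (i, j)" using H(1)[of 0] by simp
    finally show ?thesis
      using constant_if_glued_along_unit_circle[OF *] by blast
  qed
  note c = this
  {
    assume z: "z \<in> cball 0 1"
    show "Q z * mat_inv (P z) = H 0"
      using f[OF z] c z Q(1)[of z] H(1)[of 0] Pinv(1)[OF z] by (intro eq_matI) auto
  next
    assume z: "z \<in> - ball 0 1"
    show "H (1 / z) * (z ^ m \<cdot>\<^sub>m M z) = H 0"
      using g[OF z] c z H(1)[of 0] H(1)[of "1 / z"] M[OF z] by (intro eq_matI) auto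
  }
qed

lemma smult_smult_mat: "a \<cdot>\<^sub>m (b \<cdot>\<^sub>m A) = (a * b :: 'a::semigroup_mult) \<cdot>\<^sub>m A"
  by (rule eq_matI) (auto simp: mult.assoc)

lemma one_smult_mat: "(1 :: 'a::monoid_mult) \<cdot>\<^sub>m A = A"
  by (rule eq_matI) auto

lemma mat_inv_eqI:
  assumes A: "A \<in> carrier_mat n n" and B: "B \<in> carrier_mat n n" and AB: "A * B = 1\<^sub>m n"
  shows "mat_inv A = B"
proof -
  have "det A * det B = 1" using det_mult[OF A B] AB by simp
  then have "det A \<noteq> 0" by auto
  note inv = mat_inv[OF A this]
  have "mat_inv A = mat_inv A * (A * B)" using inv(1) by (simp add: AB right_mult_one_mat[of _ n n])
  also have "\<dots> = (mat_inv A * A) * B" by (rule assoc_mult_mat[OF inv(1) A B, symmetric])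
  finally show ?thesis using B by (simp add: inv(3))
qed

lemma Phi_factors_ok:
  assumes "\<And>j i. j < k \<Longrightarrow> i < l \<Longrightarrow> \<alpha> j i > 0 \<and> \<beta> j i > 0 \<and> \<gamma> j i > 0"
  shows "\<forall>f\<in>set (Phi_factors l \<alpha> \<beta> \<gamma>). fac_ok k ((\<lambda>i. \<Prod>j<k. \<beta> j i) ` {..<l}) f"
  using assms by (auto simp: Phi_factors_def)

lemma length_Bfac_Phi_factors: "length (filter is_Bfac (Phi_factors l \<alpha> \<beta> \<gamma>)) = l"
  by (induction l) (simp_all add: Phi_factors_def)

(* Column vectors are k x 1 matrices and row vectors are 1 x k matrices. *)

theorem theorem1p11:
  fixes k l N :: nat
    and \<alpha> \<beta> \<gamma> :: "nat \<Rightarrow> nat \<Rightarrow> real"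
    and F gs bs :: "nat \<Rightarrow> factor list"
    and \<phi> M P :: "complex \<Rightarrow> complex mat"
  assumes "k \<ge> 1" and "l \<ge> 1" and "N \<ge> 1"
    and "\<And>j i. j < k \<Longrightarrow> i < l \<Longrightarrow> \<alpha> j i > 0 \<and> \<beta> j i > 0 \<and> \<gamma> j i > 0"
    and "\<And>i. i < l \<Longrightarrow> (\<Prod>j<k. \<beta> j i) < 1 \<and> 1 < (\<Prod>j<k. \<alpha> j i) / (\<Prod>j<k. \<gamma> j i)"
    and "\<phi> = (\<lambda>z. Phi k l \<alpha> \<beta> \<gamma> z ^\<^sub>m (k * N))"
    and "wiener_hopf k (l * N) \<phi> M P"
    and "refactorization k (Phi_factors l \<alpha> \<beta> \<gamma>) F gs bs"
  shows "\<exists>C \<in> carrier_mat k k. invertible_mat C \<and>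
    (\<forall>(\<psi>p :: nat \<Rightarrow> complex \<Rightarrow> complex \<Rightarrow> complex mat)
      (\<psi>m :: nat \<Rightarrow> complex \<Rightarrow> complex \<Rightarrow> complex mat).
      (\<forall>(z, w) \<in> spectral_curve k l \<alpha> \<beta> \<gamma>.
         \<psi>p 0 z w \<in> carrier_mat k 1 \<and> \<psi>m 0 z w \<in> carrier_mat 1 k \<and>
         (Phi k l \<alpha> \<beta> \<gamma> z - w \<cdot>\<^sub>m 1\<^sub>m k) * \<psi>p 0 z w = 0\<^sub>m k 1 \<and>
         \<psi>m 0 z w * (Phi k l \<alpha> \<beta> \<gamma> z - w \<cdot>\<^sub>m 1\<^sub>m k) = 0\<^sub>m 1 k \<and>
         (\<forall>j<k * N. \<psi>p (Suc j) z w = prod_mat k z (bs j) * \<psi>p j z w \<and>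
                    \<psi>m (Suc j) z w = \<psi>m j z w * prod_mat k z (gs j)))
      \<longrightarrow>
      (\<forall>(z, w) \<in> spectral_curve k l \<alpha> \<beta> \<gamma>.
         (z ^ (l * N) \<cdot>\<^sub>m C) * \<psi>p (k * N) z w = ext_plus \<phi> M P z * \<psi>p 0 z w \<and>
         \<psi>m (k * N) z w * (z powi (- int (l * N)) \<cdot>\<^sub>m mat_inv C) = \<psi>m 0 z w * ext_minus \<phi> M P z))"
proof -
  define S where "S = (\<lambda>i. \<Prod>j<k. \<beta> j i) ` {..<l}"
  define fs where "fs = Phi_factors l \<alpha> \<beta> \<gamma>"
  define n m where "n = k * N" and "m = l * N"
  note k = \<open>k \<ge> 1\<close>
  have ok: "\<forall>f\<in>set fs. fac_ok k S f"
    unfolding fs_def S_def by (rule Phi_factors_ok) (use assms(4) in auto)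
  have r: "refactorization k fs F gs bs" using assms(8) by (simp add: fs_def)
  note pres = refactorization_preserves(1)[OF r k ok]
  define Gs Bs where "Gs = concat (map gs [0..<n])" and "Bs = concat (map bs (rev [0..<n]))"
  have Gs: "\<not> is_Bfac f \<and> fac_ok k S f" if "f \<in> set Gs" for f
    using that pres refactorization_switch(4)[OF r] by (auto simp: Gs_def simp del: fac_ok.simps)
  have Bs: "is_Bfac f \<and> fac_ok k S f" if "f \<in> set Bs" for f
    using that pres refactorization_switch(5)[OF r] by (auto simp: Bs_def simp del: fac_ok.simps)
  have "length (bs j) = l" for j
    using pres by (simp add: fs_def length_Bfac_Phi_factors)
  \<comment> \<open>There are kN stages with l factors each, and kNl = k m.\<close>
  then have lenBs: "length Bs = k * m"
    by (simp add: Bs_def length_concat o_def sum_list_triv n_def m_def mult_ac flip: rev_map)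
  have S: "0 < x \<and> x < 1" if "x \<in> S" for x
    using that assms(4,5) by (auto simp: S_def intro!: prod_pos)
  \<comment> \<open>The products of the \<beta> lie strictly between 0 and 1, so the closed exterior
    of the disc avoids \<open>S\<close>.\<close>
  have sphere: "z \<noteq> 0 \<and> z \<notin> of_real ` S" if "norm z \<ge> 1" for z :: complex
    using that S by fastforce

  let ?G = "\<lambda>z. prod_mat k z Gs" and ?B = "\<lambda>z. prod_mat k z Bs"
  let ?H = "\<lambda>u. inv_prod_mat k u Gs"
  have H: "?H u \<in> carrier_mat k k" for u using Gs by (intro inv_prod_mat_carrier) auto
  have G: "?G z \<in> carrier_mat k k" if "z \<noteq> 0" "z \<notin> of_real ` S" for z
    using Gs fac_mat_carrier[OF k _ that] by (intro prod_mat_carrier) auto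
  have B: "?B z \<in> carrier_mat k k" if "z \<noteq> 0" "z \<notin> of_real ` S" for z
    using Bs fac_mat_carrier[OF k _ that] by (intro prod_mat_carrier) auto
  have HG: "?H (1 / z) * ?G z = 1\<^sub>m k" if "z \<noteq> 0" "z \<notin> of_real ` S" for z
    using Gs by (intro inv_prod_mat_mult_prod_mat[OF k that]) auto
  have GH: "?G z * ?H (1 / z) = 1\<^sub>m k" if "z \<noteq> 0" "z \<notin> of_real ` S" for z
    using mat_mult_left_right_inverse[OF H G[OF that] HG[OF that]] .
  have \<phi>: "\<phi> z = ?G z * ?B z" if "z \<noteq> 0" "z \<notin> of_real ` S" for z
    using refactorization_power[OF r k ok that, of n]
    by (simp add: assms(6) Phi_def fs_def Gs_def Bs_def n_def)

  have "\<exists>p. p holomorphic_on UNIV \<and> (\<forall>z. z \<noteq> 0 \<longrightarrow> z ^ m * ?B z $$ (i, j) = p z)"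
    if "i < k" "j < k" for i j
  proof -
    note ij = that
    \<comment> \<open>The exponent m + 1 makes up for the extra factor z in the pole bound; the
      inequality rests on j < k.\<close>
    have "j + length Bs < k * Suc m + i" using ij by (simp add: lenBs)
    then obtain p where "p holomorphic_on UNIV"
      and "\<And>z. z \<noteq> 0 \<Longrightarrow> z ^ Suc m * ?B z $$ (i, j) = z * p z"
      using Bfac_prod_mat_pole_order[OF _ ij] Bs by metis
    then show ?thesis by (intro exI[of _ p]) (simp add: mult.assoc)
  qed
  then obtain p where p: "\<And>i j. i < k \<Longrightarrow> j < k \<Longrightarrow> p i j holomorphic_on UNIV"
    "\<And>i j z. i < k \<Longrightarrow> j < k \<Longrightarrow> z \<noteq> 0 \<Longrightarrow> z ^ m * ?B z $$ (i, j) = p i j z"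
    by metis
  \<comment> \<open>The entire extension of z^m B, with the singularity at 0 removed.\<close>
  define Q where "Q z = mat k k (\<lambda>(i, j). p i j z)" for z
  have Q: "Q z = z ^ m \<cdot>\<^sub>m ?B z" if "z \<noteq> 0" "z \<notin> of_real ` S" for z
    using p(2) that B[OF that] by (intro eq_matI) (auto simp: Q_def)
  have Q': "Q z \<in> carrier_mat k k" for z by (simp add: Q_def)

  note wh = assms(7)[folded m_def]
  have 1: "\<And>z. z \<in> cball 0 1 \<Longrightarrow> Q z * mat_inv (P z) = ?H 0"
    and 2: "\<And>z. z \<in> - ball 0 1 \<Longrightarrow> ?H (1 / z) * (z ^ m \<cdot>\<^sub>m M z) = ?H 0"
  proof -
    have hol: "(\<lambda>z. Q z $$ (i, j)) holomorphic_on UNIV" if "i < k" "j < k" for i j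
      using p(1)[OF that] that by (simp add: Q_def)
    have "?H (1 / z) * (z ^ m \<cdot>\<^sub>m \<phi> z) = Q z" if "z \<in> sphere 0 1" for z
    proof -
      have z: "z \<noteq> 0" "z \<notin> of_real ` S" using sphere[of z] that by auto
      have "?H (1 / z) * (z ^ m \<cdot>\<^sub>m (?G z * ?B z)) = z ^ m \<cdot>\<^sub>m ((?H (1 / z) * ?G z) * ?B z)"
        using H G[OF z] B[OF z]
        by (simp add: mult_smult_distrib[of _ k k _ k] assoc_mult_mat[of _ k k _ k _ k])
      then show ?thesis using B[OF z] by (simp add: \<phi>[OF z] Q[OF z] HG[OF z])
    qed
    note const = wiener_hopf_eq_constant[OF wh Q' hol H inv_prod_mat_holomorphic this]
    show "Q z * mat_inv (P z) = ?H 0" if "z \<in> cball 0 1" for z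
      using Gs by (intro const(1)[OF _ _ _ _ _ _ that]) auto
    show "?H (1 / z) * (z ^ m \<cdot>\<^sub>m M z) = ?H 0" if "z \<in> - ball 0 1" for z
      using Gs by (intro const(2)[OF _ _ _ _ _ _ that]) auto
  qed

  \<comment> \<open>C is the value of G at infinity, and H 0 is its inverse.\<close>
  define C where "C = mat_inv (?H 0)"
  have "det (?H 0) \<noteq> 0" using Gs by (intro det_inv_prod_mat_0[OF k]) auto
  note K = mat_inv[OF H this, folded C_def]
  have C: "mat_inv C = ?H 0" "invertible_mat C"
    using mat_inv_eqI[OF K(1) H K(3)] invertible_matI[OF K(1) H K(3,2)] by simp_all

  \<comment> \<open>The claim at the level of matrices, for all z outside 0 and \<open>S\<close>.
    The case splits follow those in \<open>ext_plus\<close> and \<open>ext_minus\<close>.\<close>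
  have plus: "(z ^ m \<cdot>\<^sub>m C) * ?B z = ext_plus \<phi> M P z"
    and minus: "?G z * (z powi (- int m) \<cdot>\<^sub>m mat_inv C) = ext_minus \<phi> M P z"
    if z: "z \<noteq> 0" "z \<notin> of_real ` S" for z
  proof -
    note assoc = assoc_mult_mat[of _ k k _ k _ k]
    note sm = mult_smult_distrib[of _ k k _ k] mult_smult_assoc_mat[of _ k k _ k]
    define w where "w = z powi (- int m)"
    have w: "w * z ^ m = 1" using z by (simp add: w_def power_int_minus)
    note car = G[OF z] B[OF z] H K(1) Q'
    have GK: "z ^ m \<cdot>\<^sub>m M z = ?G z * ?H 0" and Mcar: "M z \<in> carrier_mat k k"
      and Mdet: "det (M z) \<noteq> 0" if "norm z \<ge> 1"
    proof -
      have z': "z \<in> - ball 0 1" using that by simp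
      then show M: "M z \<in> carrier_mat k k" "det (M z) \<noteq> 0"
        using wh by (auto simp: wiener_hopf_def dest: det_nonzero_if_invertible_mat)
      have "?G z * ?H 0 = ?G z * (?H (1 / z) * (z ^ m \<cdot>\<^sub>m M z))" unfolding 2[OF z'] ..
      also have "\<dots> = (?G z * ?H (1 / z)) * (z ^ m \<cdot>\<^sub>m M z)" using car M by (simp add: assoc)
      finally show "z ^ m \<cdot>\<^sub>m M z = ?G z * ?H 0"
        using M by (simp add: GH[OF z] left_mult_one_mat[of _ k k])
    qed
    have Pcar: "P z \<in> carrier_mat k k" and Pdet: "det (P z) \<noteq> 0" if "norm z \<le> 1"
      using wh that by (auto simp: wiener_hopf_def dest: det_nonzero_if_invertible_mat)
    have Pinv: "mat_inv (P z) \<in> carrier_mat k k" "P z * mat_inv (P z) = 1\<^sub>m k"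
      "mat_inv (P z) * P z = 1\<^sub>m k" if "norm z \<le> 1"
      using mat_inv[OF Pcar[OF that] Pdet[OF that]] by simp_all
    have Minv: "mat_inv (M z) \<in> carrier_mat k k" "mat_inv (M z) * M z = 1\<^sub>m k" if "norm z \<ge> 1"
      using mat_inv[OF Mcar[OF that] Mdet[OF that]] by simp_all
    show "(z ^ m \<cdot>\<^sub>m C) * ?B z = ext_plus \<phi> M P z"
    proof (cases "norm z \<le> 1")
      case True
      note Pinv = Pinv[OF True] and Pcar = Pcar[OF True]
      have "(z ^ m \<cdot>\<^sub>m C) * ?B z = C * (Q z * (mat_inv (P z) * P z))"
        using car by (simp add: Q[OF z] Pinv sm right_mult_one_mat[of _ k k])
      also have "\<dots> = C * ((Q z * mat_inv (P z)) * P z)"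
        using car Pcar Pinv(1) by (simp add: assoc)
      also have "\<dots> = (C * ?H 0) * P z"
        using 1[of z] True car Pcar by (simp add: assoc)
      finally show ?thesis using True Pcar by (simp add: K(3) ext_plus_def)
    next
      case False
      then have "norm z \<ge> 1" by simp
      note Minv = Minv[OF this] and Mcar = Mcar[OF this] and GK = GK[OF this]
      \<comment> \<open>Inserting H(0) C = I between G and B produces G H(0), which is z^m M outside
        the disc; M then cancels.\<close>
      have "\<phi> z = ?G z * ((?H 0 * C) * ?B z)" using car by (simp add: \<phi>[OF z] K(2))
      also have "\<dots> = (?G z * ?H 0) * (C * ?B z)" using car by (simp add: assoc)
      also have "\<dots> = M z * ((z ^ m \<cdot>\<^sub>m C) * ?B z)"
        unfolding GK[symmetric] using car Mcar by (simp add: sm)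
      finally have "mat_inv (M z) * \<phi> z = (mat_inv (M z) * M z) * ((z ^ m \<cdot>\<^sub>m C) * ?B z)"
        using car Mcar Minv(1) by (simp add: assoc mult_carrier_mat[of _ k k _ k])
      then show ?thesis using False car by (simp add: Minv(2) ext_plus_def left_mult_one_mat[of _ k k]
        mult_carrier_mat[of _ k k _ k])
    qed
    show "?G z * (z powi (- int m) \<cdot>\<^sub>m mat_inv C) = ext_minus \<phi> M P z"
      unfolding w_def[symmetric] C(1)
    proof (cases "norm z \<ge> 1")
      case True
      have "?G z * (w \<cdot>\<^sub>m ?H 0) = w \<cdot>\<^sub>m (z ^ m \<cdot>\<^sub>m M z)"
        unfolding GK[OF True] using car by (simp add: sm)
      also have "\<dots> = M z" by (simp add: smult_smult_mat w one_smult_mat)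
      finally show "?G z * (w \<cdot>\<^sub>m ?H 0) = ext_minus \<phi> M P z"
        using True by (simp add: ext_minus_def)
    next
      case False
      then have "norm z \<le> 1" by simp
      note Pinv = Pinv[OF this]
      have "?B z = w \<cdot>\<^sub>m Q z" by (simp add: Q[OF z] smult_smult_mat w one_smult_mat)
      moreover have "\<phi> z * mat_inv (P z) = ?G z * (?B z * mat_inv (P z))"
        using car Pinv(1) by (simp add: \<phi>[OF z] assoc)
      moreover have "(w \<cdot>\<^sub>m Q z) * mat_inv (P z) = w \<cdot>\<^sub>m (Q z * mat_inv (P z))"
        by (rule mult_smult_assoc_mat[OF Q' Pinv(1)])
      moreover have "Q z * mat_inv (P z) = ?H 0" using 1[of z] False by simp
      ultimately show "?G z * (w \<cdot>\<^sub>m ?H 0) = ext_minus \<phi> M P z"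
        using False by (simp add: ext_minus_def)
    qed
  qed
  \<comment> \<open>The spectral curve excludes the singular points of the initial factors only; as
    all stages share \<open>S\<close>, this covers every later factor.\<close>
  have curve: "z \<noteq> 0" "z \<notin> of_real ` S" if "(z, w) \<in> spectral_curve k l \<alpha> \<beta> \<gamma>" for z w
  proof -
    show z: "z \<noteq> 0" using that by (simp add: spectral_curve_def)
    have "z \<noteq> of_real (\<Prod>j<k. \<beta> j i)" if i: "i < l" for i
    proof -
      have "invertible_mat (phi_b k z (\<lambda>j. - of_real (\<beta> j i)) (\<lambda>_. 1))"
        using \<open>(z, w) \<in> _\<close> i by (simp add: spectral_curve_def)
      then have "1 / z * (\<Prod>j<k. complex_of_real (\<beta> j i)) \<noteq> 1"
        using det_nonzero_if_invertible_mat[OF _ phi_u_carrier]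
        unfolding phi_b_eq_phi_u det_phi_u_eq_0_iff[OF k, symmetric] by blast
      then show ?thesis using z by (auto simp: of_real_prod)
    qed
    then show "z \<notin> of_real ` S" by (auto simp: S_def simp del: of_real_prod)
  qed
  show ?thesis
    unfolding m_def[symmetric] n_def[symmetric]
  proof (intro bexI[of _ C] conjI C(2) K(1) allI impI, clarify)
    fix \<psi>p \<psi>m :: "nat \<Rightarrow> complex \<Rightarrow> complex \<Rightarrow> complex mat" and z w
    assume zw: "(z, w) \<in> spectral_curve k l \<alpha> \<beta> \<gamma>"
      and "\<forall>(z, w) \<in> spectral_curve k l \<alpha> \<beta> \<gamma>.
         \<psi>p 0 z w \<in> carrier_mat k 1 \<and> \<psi>m 0 z w \<in> carrier_mat 1 k \<and>
         (Phi k l \<alpha> \<beta> \<gamma> z - w \<cdot>\<^sub>m 1\<^sub>m k) * \<psi>p 0 z w = 0\<^sub>m k 1 \<and>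
         \<psi>m 0 z w * (Phi k l \<alpha> \<beta> \<gamma> z - w \<cdot>\<^sub>m 1\<^sub>m k) = 0\<^sub>m 1 k \<and>
         (\<forall>j<n. \<psi>p (Suc j) z w = prod_mat k z (bs j) * \<psi>p j z w \<and>
                    \<psi>m (Suc j) z w = \<psi>m j z w * prod_mat k z (gs j))"
    then have \<psi>0: "\<psi>p 0 z w \<in> carrier_mat k 1" "\<psi>m 0 z w \<in> carrier_mat 1 k"
      and \<psi>: "\<And>j. j < n \<Longrightarrow> \<psi>p (Suc j) z w = prod_mat k z (bs j) * \<psi>p j z w"
        "\<And>j. j < n \<Longrightarrow> \<psi>m (Suc j) z w = \<psi>m j z w * prod_mat k z (gs j)"
      by auto
    note z = curve[OF zw]
    have car: "fac_mat k z f \<in> carrier_mat k k" if "f \<in> set (gs j) \<or> f \<in> set (bs j)" for f j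
      using pres that by (intro fac_mat_carrier[OF k _ z]) auto
    have car': "prod_mat k z (gs j) \<in> carrier_mat k k" "prod_mat k z (bs j) \<in> carrier_mat k k"
      "prod_mat k z (concat (map gs js)) \<in> carrier_mat k k"
      "prod_mat k z (concat (map bs js)) \<in> carrier_mat k k" for j js
      using car by (intro prod_mat_carrier prod_mat_concat_carrier; blast)+
    have "\<psi>p j z w = prod_mat k z (concat (map bs (rev [0..<j]))) * \<psi>p 0 z w
        \<and> \<psi>m j z w = \<psi>m 0 z w * prod_mat k z (concat (map gs [0..<j]))" if "j \<le> n" for j
      using that
    proof (induction j)
      case 0
      then show ?case using \<psi>0 by simp
    next
      case (Suc j)
      then have j: "j < n" "j \<le> n" by simp_all
      have e: "prod_mat k z (concat (map bs (rev [0..<Suc j])))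
          = prod_mat k z (bs j) * prod_mat k z (concat (map bs (rev [0..<j])))"
        "prod_mat k z (concat (map gs [0..<Suc j]))
          = prod_mat k z (concat (map gs [0..<j])) * prod_mat k z (gs j)"
        using car by (simp, subst prod_mat_append; auto)+
      show ?case
        unfolding e \<psi>[OF j(1)] Suc.IH[OF j(2), THEN conjunct1] Suc.IH[OF j(2), THEN conjunct2]
          assoc_mult_mat[OF car'(2,4) \<psi>0(1)] assoc_mult_mat[OF \<psi>0(2) car'(3,1)]
        by (intro conjI refl)
    qed
    from this[OF order_refl]
    have n: "\<psi>p n z w = ?B z * \<psi>p 0 z w" "\<psi>m n z w = \<psi>m 0 z w * ?G z"
      unfolding Gs_def Bs_def by blast+
    have "(z ^ m \<cdot>\<^sub>m C) * (?B z * \<psi>p 0 z w) = ((z ^ m \<cdot>\<^sub>m C) * ?B z) * \<psi>p 0 z w"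
      using assoc_mult_mat[OF smult_carrier_mat[OF K(1)] B[OF z] \<psi>0(1)] by simp
    moreover have "(\<psi>m 0 z w * ?G z) * (z powi (- int m) \<cdot>\<^sub>m mat_inv C)
        = \<psi>m 0 z w * (?G z * (z powi (- int m) \<cdot>\<^sub>m mat_inv C))"
      unfolding C(1) by (rule assoc_mult_mat[OF \<psi>0(2) G[OF z] smult_carrier_mat[OF H]])
    ultimately show "(z ^ m \<cdot>\<^sub>m C) * \<psi>p n z w = ext_plus \<phi> M P z * \<psi>p 0 z w \<and>
         \<psi>m n z w * (z powi (- int m) \<cdot>\<^sub>m mat_inv C) = \<psi>m 0 z w * ext_minus \<phi> M P z"
      unfolding n plus[OF z] minus[OF z] by simp
  qed
qed

end
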